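(* Let $\mathcal{A}$ be a cluster algebra of $(b,c)$-type and let $\Bbbk$ be a field. - Assume either $c>1$ or $\operatorname{char}(\Bbbk)$ divides $b$. For each $\alpha\in\Bbbk^\times$ and each $\beta\in(\Bbbk^\times)^f$ such that $\alpha^b+\beta^{-\vec{\mathsf e}_1}=0$, there is a deep point in $V(\mathcal{A},\Bbbk)$ defined by $$(x_0,x_1,x_2,x_3,y_1,\dots,y_f)\mapsto(0,\ \alpha,\ 0,\ \alpha^{-1}\beta^{[\vec{\mathsf e}_2]_-},\ \beta_1,\dots,\beta_f).$$ - Assume either $b>1$ or $\operatorname{char}(\Bbbk)$ divides $c$. For each $\alpha\in\Bbbk^\times$ and each $\beta\in(\Bbbk^\times)^f$ such that $\alpha^c+\beta^{-\vec{\mathsf e}_2}=0$, there is a deep point in $V(\mathcal{A},\Bbbk)$ defined by $$(x_0,x_1,x_2,x_3,y_1,\dots,y_f)\mapsto(\alpha^{-1}\beta^{[\vec{\mathsf e}_1]_-},\ 0,\ \alpha,\ 0,\ \beta_1,\dots,\beta_f).$$ Every deep point in $V(\mathcal{A},\Bbbk)$ is one of these two mutually exclusive types (under the corresponding assumption on $b$, $c$ and $\operatorname{char}(\Bbbk)$).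
   Context: A cluster algebra of $(b,c)$-type (with $b,c$ positive integers, $f\ge 0$, and column vectors $\vec{\mathsf e}_1,\vec{\mathsf e}_2\in\mathbb{Z}^f$) is the cluster algebra over $\mathbb{Z}$ (with inverses of frozen variables included) with initial mutable variables $x_1,x_2$, frozen variables $y_1,\dots,y_f$, and extended exchange matrix $$\begin{bmatrix}0&b\\-c&0\\-\vec{\mathsf e}_2&\vec{\mathsf e}_1\end{bmatrix}$$ (if $f=0$ there are no frozen variables). Its mutable cluster variables are denoted $x_i$, $i\in\mathbb{Z}$, so that the clusters are exactly $\{x_i,x_{i+1},y_1,\dots,y_f\}$, and mutation of $\{x_i,x_{i+1}\}$ at $x_{i}$ gives $\{x_{i+1},x_{i+2}\}$; in particular $x_0$ and $x_3$ are the mutations of $x_2$ and $x_1$ in the initial seed. For a vector $v$, $[v]_+$ and $[v]_-$ denote the componentwise $\max(v,0)$ and $\max(-v,0)$, and $y^v=\prod_j y_j^{v_j}$, $\beta^v=\prod_j\beta_j^{v_j}$. The initial exchange relations are $x_0x_2=y^{[\vec{\mathsf e}_1]_+}x_1^b+y^{[\vec{\mathsf e}_1]_-}$ and $x_1x_3=y^{[\vec{\mathsf e}_2]_+}x_2^c+y^{[\vec{\mathsf e}_2]_-}$, and it is a known result (Berenstein--Fomin--Zelevinsky) that $$\mathcal{A}\simeq\mathbb{Z}[x_0,x_1,x_2,x_3,y_1^{\pm1},\dots,y_f^{\pm1}]\big/\big\langle x_0x_2-y^{[\vec{\mathsf e}_1]_+}x_1^b-y^{[\vec{\mathsf e}_1]_-},\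 x_1x_3-y^{[\vec{\mathsf e}_2]_+}x_2^c-y^{[\vec{\mathsf e}_2]_-}\big\rangle .$$ $V(\mathcal{A},\Bbbk)=\mathrm{Hom}_{\mathrm{Ring}}(\mathcal{A},\Bbbk)$. A point $p$ is deep if for every cluster some element of the cluster is sent to $0$ by $p$; equivalently, for every $i\in\mathbb{Z}$ at least one of $p(x_i),p(x_{i+1})$ is $0$. "$\operatorname{char}(\Bbbk)$ divides $b$" means $b=0$ in $\Bbbk$. *)

theory Defs
  imports
    "HOL-Library.Poly_Mapping"
    "HOL-Computational_Algebra.Fraction_Field"
    "HOL-Algebra.Generated_Rings"
    "HOL-Algebra.Algebraic_Closure_Type"
begin

text \<open>
  Ambient field of all cluster algebras below: the fraction field of
  \<open>\<int>[X\<^sub>0, X\<^sub>1, X\<^sub>2, \<dots>]\<close>, i.e. the rational functions over \<open>\<rat>\<close>. It has infinitely many variables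
  so that the number of frozen variables may be an arbitrary natural number; a seed with
  \<open>N\<close> extended variables only involves \<open>X\<^sub>1, \<dots>, X\<^sub>N\<close>.
\<close>

type_synonym ratfun = "((nat \<Rightarrow>\<^sub>0 nat) \<Rightarrow>\<^sub>0 int) fract"

definition rvar :: "nat \<Rightarrow> ratfun" where
  "rvar i = Fract (Poly_Mapping.single (Poly_Mapping.single i 1) 1) 1"


section \<open>Seeds, mutation and cluster algebras\<close>

text \<open>
  A seed with \<open>n\<close> mutable and \<open>f\<close> frozen variables is an extended cluster indexed by
  \<open>{1..n + f}\<close> (mutable indices \<open>{1..n}\<close>, frozen indices \<open>{n+1..n+f}\<close>) together with an
  extended exchange matrix with rows \<open>{1..n + f}\<close> and columns \<open>{1..n}\<close>.
  Below, \<open>N = n + f\<close>. Note that \<open>nat z\<close> is the positive part of the integer \<open>z\<close>.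
\<close>

type_synonym seed = "(nat \<Rightarrow> ratfun) \<times> (nat \<Rightarrow> nat \<Rightarrow> int)"

definition mutate_var :: "nat \<Rightarrow> nat \<Rightarrow> seed \<Rightarrow> ratfun" where
  "mutate_var N k = (\<lambda>(x, B).
     ((\<Prod>i=1..N. x i ^ nat (B i k)) + (\<Prod>i=1..N. x i ^ nat (- B i k))) / x k)"

definition mutate_matrix :: "nat \<Rightarrow> (nat \<Rightarrow> nat \<Rightarrow> int) \<Rightarrow> nat \<Rightarrow> nat \<Rightarrow> int" where
  "mutate_matrix k B i j =
     (if i = k \<or> j = k then - B i j
      else B i j + max (B i k) 0 * max (B k j) 0 - max (- B i k) 0 * max (- B k j) 0)"

definition mutate :: "nat \<Rightarrow> nat \<Rightarrow> seed \<Rightarrow> seed" where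
  "mutate N k s = ((fst s)(k := mutate_var N k s), mutate_matrix k (snd s))"

inductive_set reachable_seeds :: "nat \<Rightarrow> nat \<Rightarrow> seed \<Rightarrow> seed set"
  for n f :: nat and s0 :: seed where
  init: "s0 \<in> reachable_seeds n f s0"
| step: "s \<in> reachable_seeds n f s0 \<Longrightarrow> k \<in> {1..n} \<Longrightarrow> mutate (n + f) k s \<in> reachable_seeds n f s0"

text \<open>The extended clusters, i.e. including the frozen variables.\<close>

definition clusters :: "nat \<Rightarrow> nat \<Rightarrow> seed \<Rightarrow> ratfun set set" where
  "clusters n f s0 = {fst s ` {1..n + f} | s. s \<in> reachable_seeds n f s0}"

definition cluster_algebra :: "nat \<Rightarrow> nat \<Rightarrow> seed \<Rightarrow> ratfun ring" where
  "cluster_algebra n f s0 = ring_of_type_algebra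
     \<lparr>carrier := generate_ring ring_of_type_algebra
        (\<Union> (clusters n f s0) \<union> {inverse (fst s0 i) | i. i \<in> {n+1..n+f}})\<rparr>"

text \<open>
  The \<open>\<bbbk>\<close>-points of the cluster algebra: ring homomorphisms to the field \<open>'k\<close>. Homomorphisms are
  taken extensional (equal to \<^const>\<open>undefined\<close> outside the carrier), so that
  two points are equal iff they agree on the cluster algebra.
\<close>

definition cluster_points :: "nat \<Rightarrow> nat \<Rightarrow> seed \<Rightarrow> (ratfun \<Rightarrow> 'k::field) set" where
  "cluster_points n f s0 =
     ring_hom (cluster_algebra n f s0) ring_of_type_algebra
       \<inter> extensional (carrier (cluster_algebra n f s0))"

definition deep_points :: "nat \<Rightarrow> nat \<Rightarrow> seed \<Rightarrow> (ratfun \<Rightarrow> 'k::field) set" where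
  "deep_points n f s0 =
     {p \<in> cluster_points n f s0. \<forall>C \<in> clusters n f s0. \<exists>z \<in> C. p z = 0}"


section \<open>Cluster algebras of \<open>(b, c)\<close>-type\<close>

text \<open>
  The vectors \<open>e1, e2 \<in> \<int>\<^sup>f\<close> are functions of which only the values on \<open>{1..f}\<close> are used.
  Index 1 and 2 are the mutable variables \<open>x\<^sub>1, x\<^sub>2\<close>; index \<open>2 + j\<close> is the frozen variable \<open>y\<^sub>j\<close>.
\<close>

definition bc_matrix ::
  "nat \<Rightarrow> nat \<Rightarrow> nat \<Rightarrow> (nat \<Rightarrow> int) \<Rightarrow> (nat \<Rightarrow> int) \<Rightarrow> nat \<Rightarrow> nat \<Rightarrow> int" where
  "bc_matrix b c f e1 e2 i j =
     (if i = 1 \<and> j = 2 then int b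
      else if i = 2 \<and> j = 1 then - int c
      else if i \<in> {3..f+2} \<and> j = 1 then - e2 (i - 2)
      else if i \<in> {3..f+2} \<and> j = 2 then e1 (i - 2)
      else 0)"

definition bc_seed ::
  "nat \<Rightarrow> nat \<Rightarrow> nat \<Rightarrow> (nat \<Rightarrow> int) \<Rightarrow> (nat \<Rightarrow> int) \<Rightarrow> seed" where
  "bc_seed b c f e1 e2 = (rvar, bc_matrix b c f e1 e2)"

definition bc_x1 :: ratfun where "bc_x1 = rvar 1"

definition bc_x2 :: ratfun where "bc_x2 = rvar 2"

definition bc_y :: "nat \<Rightarrow> ratfun" where "bc_y j = rvar (2 + j)"

definition bc_x0 ::
  "nat \<Rightarrow> nat \<Rightarrow> nat \<Rightarrow> (nat \<Rightarrow> int) \<Rightarrow> (nat \<Rightarrow> int) \<Rightarrow> ratfun" where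
  "bc_x0 b c f e1 e2 = mutate_var (2 + f) 2 (bc_seed b c f e1 e2)"

definition bc_x3 ::
  "nat \<Rightarrow> nat \<Rightarrow> nat \<Rightarrow> (nat \<Rightarrow> int) \<Rightarrow> (nat \<Rightarrow> int) \<Rightarrow> ratfun" where
  "bc_x3 b c f e1 e2 = mutate_var (2 + f) 1 (bc_seed b c f e1 e2)"

definition vec_pos :: "(nat \<Rightarrow> int) \<Rightarrow> nat \<Rightarrow> int" where "vec_pos v j = max (v j) 0"

definition vec_neg :: "(nat \<Rightarrow> int) \<Rightarrow> nat \<Rightarrow> int" where "vec_neg v j = max (- v j) 0"

text \<open>\<open>vec_power f y v\<close> is \<open>y\<^sup>v = \<Prod>\<^sub>j y\<^sub>j\<^bsup>v\<^sub>j\<^esup>\<close>.\<close>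

definition vec_power :: "nat \<Rightarrow> (nat \<Rightarrow> 'a::field) \<Rightarrow> (nat \<Rightarrow> int) \<Rightarrow> 'a" where
  "vec_power f y v = (\<Prod>j=1..f. y j powi v j)"

lemma prod_bc_seed_split:
  fixes g :: "nat \<Rightarrow> 'a::comm_monoid_mult"
  shows "prod g {1..2 + f} = g 1 * g 2 * (\<Prod>j=1..f. g (j + 2))"
proof -
  have "{1..2 + f} = {1, 2} \<union> {1 + 2..f + 2}" by auto
  then have "prod g {1..2 + f} = prod g {1, 2} * prod g {1 + 2..f + 2}"
    by (simp add: prod.union_disjoint del: Un_insert_left)
  then show ?thesis
    by (simp only: prod.shift_bounds_cl_nat_ivl) simp
qed

lemma rvar_nonzero: "rvar i \<noteq> 0"
proof -
  have "Poly_Mapping.single (Poly_Mapping.single i (1::nat)) (1::int) \<noteq> 0"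
    by (metis lookup_single_eq lookup_zero zero_neq_one)
  then show ?thesis by (simp add: rvar_def Zero_fract_def eq_fract)
qed

lemma nat_powi: "z ^ nat k = z powi max k 0"
  by (auto simp: power_int_def max_def)

lemma bc_exchange_relations:
  shows "bc_x0 b c f e1 e2 * bc_x2
           = vec_power f bc_y (vec_pos e1) * bc_x1 ^ b + vec_power f bc_y (vec_neg e1)"
    and "bc_x1 * bc_x3 b c f e1 e2
           = vec_power f bc_y (vec_pos e2) * bc_x2 ^ c + vec_power f bc_y (vec_neg e2)"
proof -
  let ?B = "bc_matrix b c f e1 e2"
  have B: "?B 1 2 = int b" "?B 2 2 = 0" "?B 1 1 = 0" "?B 2 1 = - int c" by (simp_all add: bc_matrix_def)
  have y: "(\<Prod>j=1..f. rvar (j + 2) ^ nat (?B (j + 2) 2)) = vec_power f bc_y (vec_pos e1)"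
      "(\<Prod>j=1..f. rvar (j + 2) ^ nat (- ?B (j + 2) 2)) = vec_power f bc_y (vec_neg e1)"
      "(\<Prod>j=1..f. rvar (j + 2) ^ nat (?B (j + 2) 1)) = vec_power f bc_y (vec_neg e2)"
      "(\<Prod>j=1..f. rvar (j + 2) ^ nat (- ?B (j + 2) 1)) = vec_power f bc_y (vec_pos e2)"
    unfolding vec_power_def
    by (rule prod.cong[OF refl],
        simp add: nat_powi bc_matrix_def vec_pos_def vec_neg_def bc_y_def)+
  show "bc_x0 b c f e1 e2 * bc_x2
           = vec_power f bc_y (vec_pos e1) * bc_x1 ^ b + vec_power f bc_y (vec_neg e1)"
    unfolding bc_x0_def bc_x1_def bc_x2_def mutate_var_def bc_seed_def
    by (simp only: prod.case prod_bc_seed_split B y) (simp add: rvar_nonzero mult.commute)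
  show "bc_x1 * bc_x3 b c f e1 e2
           = vec_power f bc_y (vec_pos e2) * bc_x2 ^ c + vec_power f bc_y (vec_neg e2)"
    unfolding bc_x3_def bc_x1_def bc_x2_def mutate_var_def bc_seed_def
    by (simp only: prod.case prod_bc_seed_split B y) (simp add: rvar_nonzero mult.commute add.commute)
qed

text \<open>\<open>p\<close> is given by \<open>(x\<^sub>0, x\<^sub>1, x\<^sub>2, x\<^sub>3, y\<^sub>1, \<dots>, y\<^sub>f) \<mapsto> (a\<^sub>0, a\<^sub>1, a\<^sub>2, a\<^sub>3, \<beta>\<^sub>1, \<dots>, \<beta>\<^sub>f)\<close>.\<close>

definition has_values ::
  "nat \<Rightarrow> nat \<Rightarrow> nat \<Rightarrow> (nat \<Rightarrow> int) \<Rightarrow> (nat \<Rightarrow> int) \<Rightarrow> (ratfun \<Rightarrow> 'k::field)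
     \<Rightarrow> 'k \<times> 'k \<times> 'k \<times> 'k \<Rightarrow> (nat \<Rightarrow> 'k) \<Rightarrow> bool" where
  "has_values b c f e1 e2 p a \<beta> \<longleftrightarrow>
     (p (bc_x0 b c f e1 e2), p bc_x1, p bc_x2, p (bc_x3 b c f e1 e2)) = a \<and>
     (\<forall>j\<in>{1..f}. p (bc_y j) = \<beta> j)"

definition deep_parameters ::
  "nat \<Rightarrow> nat \<Rightarrow> (nat \<Rightarrow> int) \<Rightarrow> 'k::field \<Rightarrow> (nat \<Rightarrow> 'k) \<Rightarrow> bool" where
  "deep_parameters d f e \<alpha> \<beta> \<longleftrightarrow>
     \<alpha> \<noteq> 0 \<and> (\<forall>j\<in>{1..f}. \<beta> j \<noteq> 0) \<and> \<alpha> ^ d + vec_power f \<beta> (\<lambda>j. - e j) = 0"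

definition first_type ::
  "nat \<Rightarrow> nat \<Rightarrow> nat \<Rightarrow> (nat \<Rightarrow> int) \<Rightarrow> (nat \<Rightarrow> int) \<Rightarrow> (ratfun \<Rightarrow> 'k::field) \<Rightarrow> bool" where
  "first_type b c f e1 e2 p \<longleftrightarrow>
     (\<exists>\<alpha> \<beta>. deep_parameters b f e1 \<alpha> \<beta> \<and>
       has_values b c f e1 e2 p (0, \<alpha>, 0, inverse \<alpha> * vec_power f \<beta> (vec_neg e2)) \<beta>)"

definition second_type ::
  "nat \<Rightarrow> nat \<Rightarrow> nat \<Rightarrow> (nat \<Rightarrow> int) \<Rightarrow> (nat \<Rightarrow> int) \<Rightarrow> (ratfun \<Rightarrow> 'k::field) \<Rightarrow> bool" where
  "second_type b c f e1 e2 p \<longleftrightarrow>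
     (\<exists>\<alpha> \<beta>. deep_parameters c f e2 \<alpha> \<beta> \<and>
       has_values b c f e1 e2 p (inverse \<alpha> * vec_power f \<beta> (vec_neg e1), 0, \<alpha>, 0) \<beta>)"

end

theory Submission
  imports Defs
begin

text \<open>
  Write \<open>x\<^sub>0, x\<^sub>1, x\<^sub>2, x\<^sub>3\<close> for the initial cluster variables and their two neighbours. The proof rests on one
  formula. If \<open>x, y\<close> is a cluster with neighbours \<open>x', y'\<close>, then the variable \<open>y''\<close> that replaces \<open>y\<close> in the
  cluster \<open>x', y\<close> is a polynomial in \<open>x, y, x', y'\<close> over the Laurent polynomials in the frozen variables
  (\<open>fourth_variable_formula\<close>). It has three consequences.

  First, every subring that contains \<open>x\<^sub>0, x\<^sub>1, x\<^sub>2, x\<^sub>3\<close> and the frozen variables with their inverses contains all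
  cluster variables, by induction along mutations (\<open>rank2_cluster_algebra_subset\<close>). Hence a point is determined by
  its values on these generators (\<open>cluster_point_unique\<close>).

  Second, it replaces a presentation of the algebra when a point with prescribed values is to be
  constructed (\<open>cluster_point_exists\<close>). To send, say, \<open>x\<^sub>1\<close> to \<open>\<alpha>\<close> and \<open>x\<^sub>2\<close> to \<open>0\<close>, one sends \<open>x\<^sub>1\<close> to \<open>\<alpha>\<close> and \<open>x\<^sub>2\<close>
  to an indeterminate \<open>t\<close>. The equation for \<open>\<alpha>\<close> and \<open>\<beta>\<close> makes the image of \<open>x\<^sub>0\<close> vanish, so that all generators
  land in the local ring of rational functions without pole at \<open>t = 0\<close>, where \<open>t\<close> can be set to \<open>0\<close>.

  Third, evaluated at a point with \<open>y, y' \<mapsto> 0\<close>, the formula shows that \<open>y''\<close> vanishes if and only if the exponent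
  in the relation for \<open>x x'\<close> is greater than \<open>1\<close> or the exponent in the relation for \<open>y y'\<close> is \<open>0\<close> in the field
  (\<open>fourth_variable_at_zeros\<close>). If this holds, zeros propagate to every other cluster variable
  (\<open>reachable_zeros\<close>), so the constructed points are deep.

  Conversely, at a deep point exactly one initial variable vanishes. Indeed the frozen variables are units,
  so one of the two vanishes, and if both did, an exchange relation would send a unit to \<open>0\<close>. The neighbouring
  clusters then force the values in the theorem, and the cluster one step further, which contains \<open>y''\<close>, forces the
  condition on \<open>b\<close>, \<open>c\<close> and the characteristic (\<open>deep_point_classification\<close>).
\<close>

section \<open>Ring homomorphisms on subrings of a field\<close>

text \<open>
  A point of the cluster algebra is a homomorphism that makes sense only on a subring of the
  ambient field of rational functions. The locale keeps this in type-class algebra: a set closed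
  under the ring operations, together with a function that respects them on that set.
\<close>

locale hom_on_subring =
  fixes R :: "'a::field set" and p :: "'a \<Rightarrow> 'b::field"
  assumes one_mem: "1 \<in> R"
    and add_mem: "\<And>x y. x \<in> R \<Longrightarrow> y \<in> R \<Longrightarrow> x + y \<in> R"
    and mult_mem: "\<And>x y. x \<in> R \<Longrightarrow> y \<in> R \<Longrightarrow> x * y \<in> R"
    and uminus_mem: "\<And>x. x \<in> R \<Longrightarrow> - x \<in> R"
    and hom_one: "p 1 = 1"
    and hom_add: "\<And>x y. x \<in> R \<Longrightarrow> y \<in> R \<Longrightarrow> p (x + y) = p x + p y"
    and hom_mult: "\<And>x y. x \<in> R \<Longrightarrow> y \<in> R \<Longrightarrow> p (x * y) = p x * p y"
begin

lemma zero_mem: "0 \<in> R"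
  using add_mem[OF one_mem uminus_mem[OF one_mem]] by simp

lemma hom_zero: "p 0 = 0"
proof -
  have "p 0 + p 0 = p 0" using hom_add[OF zero_mem zero_mem] by simp
  then show ?thesis by (metis add_cancel_right_right)
qed

lemma hom_uminus: "x \<in> R \<Longrightarrow> p (- x) = - p x"
  using hom_add[of x "- x"] uminus_mem[of x] by (simp add: hom_zero eq_neg_iff_add_eq_0 add.commute)

lemma diff_mem: "x \<in> R \<Longrightarrow> y \<in> R \<Longrightarrow> x - y \<in> R"
  using add_mem[of x "- y"] uminus_mem by simp

lemma hom_diff: "x \<in> R \<Longrightarrow> y \<in> R \<Longrightarrow> p (x - y) = p x - p y"
  using hom_add[of x "- y"] uminus_mem hom_uminus by simp

lemma power_mem: "x \<in> R \<Longrightarrow> x ^ n \<in> R"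
  by (induction n) (auto simp: one_mem mult_mem)

lemma hom_power: "x \<in> R \<Longrightarrow> p (x ^ n) = p x ^ n"
  by (induction n) (auto simp: hom_one hom_mult power_mem)

lemma prod_mem: "(\<And>i. i \<in> I \<Longrightarrow> g i \<in> R) \<Longrightarrow> prod g I \<in> R"
  by (induction I rule: infinite_finite_induct) (auto simp: one_mem mult_mem)

lemma hom_prod: "(\<And>i. i \<in> I \<Longrightarrow> g i \<in> R) \<Longrightarrow> p (prod g I) = (\<Prod>i\<in>I. p (g i))"
  by (induction I rule: infinite_finite_induct) (auto simp: hom_one hom_mult prod_mem)

lemma sum_mem: "(\<And>i. i \<in> I \<Longrightarrow> g i \<in> R) \<Longrightarrow> sum g I \<in> R"
  by (induction I rule: infinite_finite_induct) (auto simp: zero_mem add_mem)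

lemma hom_sum: "(\<And>i. i \<in> I \<Longrightarrow> g i \<in> R) \<Longrightarrow> p (sum g I) = (\<Sum>i\<in>I. p (g i))"
  by (induction I rule: infinite_finite_induct) (auto simp: hom_zero hom_add sum_mem)

lemma hom_inverse:
  assumes "x \<in> R" "inverse x \<in> R" "x \<noteq> 0"
  shows "p x \<noteq> 0" "p (inverse x) = inverse (p x)"
proof -
  have "p x * p (inverse x) = 1"
    using hom_mult[OF assms(1,2)] assms(3) by (simp add: hom_one)
  then show "p x \<noteq> 0" "p (inverse x) = inverse (p x)"
    by (auto simp: inverse_unique)
qed

lemma vec_power_mem:
  assumes "\<And>j. j \<in> {1..f} \<Longrightarrow> y j \<in> R" and "\<And>j. v j \<ge> 0"
  shows "vec_power f y v \<in> R"
  unfolding vec_power_def using assms by (auto intro!: prod_mem power_mem simp: power_int_def)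

lemma hom_vec_power:
  assumes "\<And>j. j \<in> {1..f} \<Longrightarrow> y j \<in> R" and "\<And>j. v j \<ge> 0"
  shows "p (vec_power f y v) = vec_power f (\<lambda>j. p (y j)) v"
proof -
  have "p (vec_power f y v) = (\<Prod>j=1..f. p (y j powi v j))"
    unfolding vec_power_def using assms
    by (intro hom_prod) (auto simp: power_int_def power_mem)
  also have "\<dots> = vec_power f (\<lambda>j. p (y j)) v"
    unfolding vec_power_def using assms by (intro prod.cong) (auto simp: power_int_def hom_power)
  finally show ?thesis .
qed

lemma restrict_hom:
  assumes "S \<subseteq> R" "1 \<in> S" "\<And>x y. x \<in> S \<Longrightarrow> y \<in> S \<Longrightarrow> x + y \<in> S"
    "\<And>x y. x \<in> S \<Longrightarrow> y \<in> S \<Longrightarrow> x * y \<in> S" "\<And>x. x \<in> S \<Longrightarrow> - x \<in> S"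
    and "\<And>x. x \<in> S \<Longrightarrow> q x = p x"
  shows "hom_on_subring S q"
  using assms by unfold_locales (auto simp: hom_one subset_iff hom_add hom_mult)

text \<open>
  Two homomorphisms that agree on generators agree on the generated ring, because the set where
  they agree is again a subring.
\<close>

lemma equalizer:
  assumes "hom_on_subring R q"
  shows "hom_on_subring {x \<in> R. p x = q x} p"
proof -
  interpret q: hom_on_subring R q by fact
  show ?thesis
    by (rule restrict_hom)
      (auto simp: one_mem add_mem mult_mem uminus_mem hom_one q.hom_one hom_add q.hom_add
        hom_mult q.hom_mult hom_uminus q.hom_uminus)
qed

end

lemma hom_on_subring_compose:
  assumes "hom_on_subring R p" "hom_on_subring S q"
  shows "hom_on_subring {x \<in> R. p x \<in> S} (\<lambda>x. q (p x))"
proof -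
  interpret p: hom_on_subring R p by fact
  interpret q: hom_on_subring S q by fact
  show ?thesis
    by unfold_locales
      (auto simp: p.one_mem p.add_mem p.mult_mem p.uminus_mem p.hom_one p.hom_add
        p.hom_mult p.hom_uminus q.one_mem q.add_mem q.mult_mem q.uminus_mem q.hom_one q.hom_add
        q.hom_mult)
qed

section \<open>Extending a homomorphism to a local ring of fractions\<close>

text \<open>
  A homomorphism \<open>h\<close> from a domain to a field extends, by \<open>a / b \<mapsto> h a / h b\<close>, to those fractions that
  have some representation with a denominator outside the kernel of \<open>h\<close>, i.e. to the
  localisation at the prime ideal \<open>ker h\<close>.
\<close>

locale idom_hom_to_field =
  fixes h :: "'a::idom \<Rightarrow> 'b::field"
  assumes h_one: "h 1 = 1"
    and h_add: "\<And>x y. h (x + y) = h x + h y"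
    and h_mult: "\<And>x y. h (x * y) = h x * h y"
begin

lemma h_zero: "h 0 = 0"
proof -
  have "h 0 + h 0 = h 0" using h_add[of 0 0] by simp
  then show ?thesis by (metis add_cancel_right_right)
qed

lemma h_uminus: "h (- x) = - h x"
  using h_add[of x "- x"] by (simp add: h_zero eq_neg_iff_add_eq_0 add.commute)

definition local_ring :: "'a fract set" where
  "local_ring = {Fract a b | a b. h b \<noteq> 0}"

definition place :: "'a fract \<Rightarrow> 'b" where
  "place q = (SOME v. \<exists>a b. q = Fract a b \<and> h b \<noteq> 0 \<and> v = h a / h b)"

lemma place_Fract:
  assumes "h b \<noteq> 0"
  shows "place (Fract a b) = h a / h b"
proof -
  have "v = h a / h b" if "Fract a b = Fract a' b'" "h b' \<noteq> 0" "v = h a' / h b'" for v a' b'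
  proof -
    have "b \<noteq> 0" "b' \<noteq> 0" using assms that h_zero by auto
    then have "h (a * b') = h (a' * b)" using that by (simp add: eq_fract)
    then show ?thesis using that(2,3) assms by (simp add: h_mult frac_eq_eq)
  qed
  then show ?thesis
    unfolding place_def using assms by (intro some_equality) blast+
qed

lemma Fract_mem: "h b \<noteq> 0 \<Longrightarrow> Fract a b \<in> local_ring"
  unfolding local_ring_def by blast

lemma place_of_base: "Fract a 1 \<in> local_ring" "place (Fract a 1) = h a"
  using Fract_mem[of 1 a] place_Fract[of 1 a] by (simp_all add: h_one)

sublocale place: hom_on_subring local_ring place
proof
  show "1 \<in> local_ring" "place 1 = 1"
    using place_of_base[of 1] by (simp_all add: One_fract_def h_one)
next
  fix x y assume "x \<in> local_ring" "y \<in> local_ring"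
  then obtain a b a' b' where *: "x = Fract a b" "y = Fract a' b'" "h b \<noteq> 0" "h b' \<noteq> 0"
    unfolding local_ring_def by blast
  then have nz: "b \<noteq> 0" "b' \<noteq> 0" "h (b * b') \<noteq> 0" using h_zero by (auto simp: h_mult)
  show "x + y \<in> local_ring" "x * y \<in> local_ring" "- x \<in> local_ring"
    using * nz by (simp_all add: Fract_mem)
  show "place (x + y) = place x + place y" "place (x * y) = place x * place y"
    using * nz by (simp_all add: place_Fract h_add h_mult field_simps)
qed

lemma inverse_mem:
  assumes "x \<in> local_ring" "place x \<noteq> 0"
  shows "inverse x \<in> local_ring"
proof -
  obtain a b where "x = Fract a b" "h b \<noteq> 0" using assms unfolding local_ring_def by blast
  then show ?thesis using assms by (simp add: place_Fract Fract_mem)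
qed

lemma divide_mem:
  assumes "x \<in> local_ring" "y \<in> local_ring" "place y \<noteq> 0"
  shows "x / y \<in> local_ring" "place (x / y) = place x / place y"
proof -
  have y: "y \<noteq> 0" "inverse y \<in> local_ring" using assms place.hom_zero inverse_mem by auto
  then show "x / y \<in> local_ring" using assms by (simp add: divide_inverse place.mult_mem)
  show "place (x / y) = place x / place y"
    using assms y by (simp add: divide_inverse place.hom_mult place.hom_inverse)
qed

end

section \<open>Evaluation of integer polynomials\<close>

definition eval_monomial :: "(nat \<Rightarrow> 'k::field) \<Rightarrow> (nat \<Rightarrow>\<^sub>0 nat) \<Rightarrow> 'k" where
  "eval_monomial g m = (\<Prod>i\<in>Poly_Mapping.keys m. g i ^ Poly_Mapping.lookup m i)"

definition eval_poly :: "(nat \<Rightarrow> 'k::field) \<Rightarrow> ((nat \<Rightarrow>\<^sub>0 nat) \<Rightarrow>\<^sub>0 int) \<Rightarrow> 'k" where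
  "eval_poly g P = (\<Sum>m\<in>Poly_Mapping.keys P. of_int (Poly_Mapping.lookup P m) * eval_monomial g m)"

lemma eval_monomial_superset:
  "finite I \<Longrightarrow> Poly_Mapping.keys m \<subseteq> I \<Longrightarrow> eval_monomial g m = (\<Prod>i\<in>I. g i ^ Poly_Mapping.lookup m i)"
  unfolding eval_monomial_def by (rule prod.mono_neutral_left) (auto simp: in_keys_iff)

lemma eval_monomial_add: "eval_monomial g (m + n) = eval_monomial g m * eval_monomial g n"
proof -
  let ?I = "Poly_Mapping.keys m \<union> Poly_Mapping.keys n"
  have "Poly_Mapping.keys (m + n) \<subseteq> ?I" by (rule Poly_Mapping.keys_add)
  then show ?thesis
    by (simp add: eval_monomial_superset[of ?I] lookup_add power_add prod.distrib)
qed

lemma eval_poly_superset: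
  "finite I \<Longrightarrow> Poly_Mapping.keys P \<subseteq> I \<Longrightarrow>
     eval_poly g P = (\<Sum>m\<in>I. of_int (Poly_Mapping.lookup P m) * eval_monomial g m)"
  unfolding eval_poly_def by (rule sum.mono_neutral_left) (auto simp: in_keys_iff)

lemma eval_poly_add: "eval_poly g (P + Q) = eval_poly g P + eval_poly g Q"
proof -
  let ?I = "Poly_Mapping.keys P \<union> Poly_Mapping.keys Q"
  have "Poly_Mapping.keys (P + Q) \<subseteq> ?I" by (rule Poly_Mapping.keys_add)
  then show ?thesis
    by (simp add: eval_poly_superset[of ?I] lookup_add algebra_simps sum.distrib)
qed

lemma eval_poly_single: "eval_poly g (Poly_Mapping.single m a) = of_int a * eval_monomial g m"
  by (subst eval_poly_superset[of "{m}"]) auto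

lemma eval_poly_sum: "eval_poly g (sum P I) = (\<Sum>i\<in>I. eval_poly g (P i))"
  by (induction I rule: infinite_finite_induct)
    (auto simp: eval_poly_add, simp_all add: eval_poly_def)

lemma sum_of_singles:
  "P = (\<Sum>m\<in>Poly_Mapping.keys P. Poly_Mapping.single m (Poly_Mapping.lookup P m))"
  by (rule poly_mapping_eqI) (simp add: lookup_sum lookup_single when_def in_keys_iff)

lemma eval_poly_mult: "eval_poly g (P * Q) = eval_poly g P * eval_poly g Q"
proof -
  have "P * Q = (\<Sum>m\<in>Poly_Mapping.keys P. Poly_Mapping.single m (Poly_Mapping.lookup P m)) *
      (\<Sum>n\<in>Poly_Mapping.keys Q. Poly_Mapping.single n (Poly_Mapping.lookup Q n))"
    by (simp only: sum_of_singles[symmetric])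
  then have "P * Q = (\<Sum>m\<in>Poly_Mapping.keys P. \<Sum>n\<in>Poly_Mapping.keys Q.
      Poly_Mapping.single (m + n) (Poly_Mapping.lookup P m * Poly_Mapping.lookup Q n))"
    by (simp add: sum_product mult_single)
  then have "eval_poly g (P * Q) = (\<Sum>m\<in>Poly_Mapping.keys P. \<Sum>n\<in>Poly_Mapping.keys Q.
      of_int (Poly_Mapping.lookup P m) * eval_monomial g m *
      (of_int (Poly_Mapping.lookup Q n) * eval_monomial g n))"
    by (simp add: eval_poly_sum eval_poly_single eval_monomial_add algebra_simps)
  then show ?thesis by (simp add: eval_poly_def sum_product)
qed

lemma eval_poly_hom: "idom_hom_to_field (eval_poly g)"
proof
  show "eval_poly g 1 = 1"
    using eval_poly_single[of g 0 1] by (simp add: eval_monomial_def)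
qed (simp_all add: eval_poly_add eval_poly_mult)

lemma eval_poly_var:
  "eval_poly g (Poly_Mapping.single (Poly_Mapping.single i 1) 1) = g i"
  by (simp add: eval_poly_single eval_monomial_superset[of "{i}"])

lemma eval_at_zero_hom: "idom_hom_to_field (\<lambda>P. poly P (0::'k::field))"
  by unfold_locales auto

lemma place_rvar:
  "rvar i \<in> idom_hom_to_field.local_ring (eval_poly g)"
  "idom_hom_to_field.place (eval_poly g) (rvar i) = g i"
proof -
  interpret idom_hom_to_field "eval_poly g" by (rule eval_poly_hom)
  show "rvar i \<in> local_ring" "place (rvar i) = g i"
    unfolding rvar_def using place_of_base eval_poly_var by auto
qed

section \<open>Points of a cluster algebra\<close>

lemma ring_of_type_algebra_ops:
  fixes x y :: "'a::comm_ring_1"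
  shows "\<one>\<^bsub>ring_of_type_algebra\<^esub> = (1 :: 'a)"
    and "x \<oplus>\<^bsub>ring_of_type_algebra\<^esub> y = x + y"
    and "x \<otimes>\<^bsub>ring_of_type_algebra\<^esub> y = x * y"
    and "\<ominus>\<^bsub>ring_of_type_algebra\<^esub> x = - x"
proof -
  interpret ring "ring_of_type_algebra :: 'a ring" by (rule ring_from_type_algebra)
  show "\<ominus>\<^bsub>ring_of_type_algebra\<^esub> x = - x"
    by (rule minus_equality) (auto simp: ring_of_type_algebra_def)
qed (simp_all add: ring_of_type_algebra_def)

lemma cluster_algebra_carrier:
  "carrier (cluster_algebra n f s0) = generate_ring ring_of_type_algebra
        (\<Union> (clusters n f s0) \<union> {inverse (fst s0 i) | i. i \<in> {n+1..n+f}})"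
  by (simp add: cluster_algebra_def)

lemma cluster_algebra_closed:
  fixes n f :: nat and s :: seed
  defines "A \<equiv> carrier (cluster_algebra n f s)"
  shows "1 \<in> A" "\<And>x y. x \<in> A \<Longrightarrow> y \<in> A \<Longrightarrow> x + y \<in> A"
    "\<And>x y. x \<in> A \<Longrightarrow> y \<in> A \<Longrightarrow> x * y \<in> A" "\<And>x. x \<in> A \<Longrightarrow> - x \<in> A"
  unfolding A_def cluster_algebra_carrier ring_of_type_algebra_ops[symmetric]
  by (rule generate_ring.intros; assumption?)+

lemma cluster_points_iff:
  "p \<in> cluster_points n f s0 \<longleftrightarrow>
     hom_on_subring (carrier (cluster_algebra n f s0)) p \<and>
     p \<in> extensional (carrier (cluster_algebra n f s0))"
proof -
  let ?A = "carrier (cluster_algebra n f s0)"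
  have ops: "\<one>\<^bsub>cluster_algebra n f s0\<^esub> = 1"
      "\<And>x y. x \<oplus>\<^bsub>cluster_algebra n f s0\<^esub> y = x + y"
      "\<And>x y. x \<otimes>\<^bsub>cluster_algebra n f s0\<^esub> y = x * y"
    by (simp_all add: cluster_algebra_def ring_of_type_algebra_def)
  have "p \<in> ring_hom (cluster_algebra n f s0) ring_of_type_algebra \<longleftrightarrow> hom_on_subring ?A p"
    unfolding ring_hom_def hom_on_subring_def ops
    using cluster_algebra_closed[where n=n and f=f and s=s0]
    by (auto simp: ring_of_type_algebra_def)
  then show ?thesis by (simp add: cluster_points_def)
qed

lemma cluster_algebra_subset:
  assumes "hom_on_subring R p"
    and "\<And>s i. s \<in> reachable_seeds n f s0 \<Longrightarrow> i \<in> {1..n + f} \<Longrightarrow> fst s i \<in> R"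
    and "\<And>i. i \<in> {n+1..n+f} \<Longrightarrow> inverse (fst s0 i) \<in> R"
  shows "carrier (cluster_algebra n f s0) \<subseteq> R"
proof
  interpret hom_on_subring R p by fact
  fix x assume "x \<in> carrier (cluster_algebra n f s0)"
  then show "x \<in> R"
    unfolding cluster_algebra_carrier
  proof induction
    case (incl h)
    then show ?case using assms by (auto simp: clusters_def)
  qed (auto simp: ring_of_type_algebra_ops one_mem add_mem mult_mem uminus_mem)
qed

lemma cluster_variable_mem:
  "s \<in> reachable_seeds n f s0 \<Longrightarrow> i \<in> {1..n + f} \<Longrightarrow> fst s i \<in> carrier (cluster_algebra n f s0)"
  unfolding cluster_algebra_carrier clusters_def by (rule generate_ring.incl) blast

lemma inverse_frozen_mem:
  "i \<in> {n+1..n+f} \<Longrightarrow> inverse (fst s0 i) \<in> carrier (cluster_algebra n f s0)"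
  unfolding cluster_algebra_carrier by (rule generate_ring.incl) blast

section \<open>Positivity of cluster variables\<close>

text \<open>
  Exchange relations divide by cluster variables, so these must be known to be nonzero in the
  ambient field. Mutation only uses sums, products and quotients, so the value of every cluster
  variable at the point where all initial variables are \<open>1\<close> is a positive rational number.
\<close>

interpretation at_one: idom_hom_to_field "eval_poly (\<lambda>_. 1::rat)"
  by (rule eval_poly_hom)

definition positive_at_one :: "ratfun \<Rightarrow> bool" where
  "positive_at_one q \<longleftrightarrow> q \<in> at_one.local_ring \<and> at_one.place q > 0"

lemma positive_at_one_nonzero: "positive_at_one q \<Longrightarrow> q \<noteq> 0"
  using at_one.place.hom_zero by (auto simp: positive_at_one_def)

lemma positive_at_one_rvar: "positive_at_one (rvar i)"
  using place_rvar[where g = "\<lambda>_. 1::rat"] by (simp add: positive_at_one_def)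

lemma positive_at_one_mult: "positive_at_one x \<Longrightarrow> positive_at_one y \<Longrightarrow> positive_at_one (x * y)"
  by (simp add: positive_at_one_def at_one.place.mult_mem at_one.place.hom_mult)

lemma positive_at_one_add: "positive_at_one x \<Longrightarrow> positive_at_one y \<Longrightarrow> positive_at_one (x + y)"
  by (simp add: positive_at_one_def at_one.place.add_mem at_one.place.hom_add)

lemma positive_at_one_power: "positive_at_one x \<Longrightarrow> positive_at_one (x ^ n)"
  by (simp add: positive_at_one_def at_one.place.power_mem at_one.place.hom_power)

lemma positive_at_one_divide: "positive_at_one x \<Longrightarrow> positive_at_one y \<Longrightarrow> positive_at_one (x / y)"
  by (simp add: positive_at_one_def at_one.divide_mem)

lemma positive_at_one_prod: "(\<And>i. i \<in> I \<Longrightarrow> positive_at_one (g i)) \<Longrightarrow> positive_at_one (prod g I)"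
  using at_one.place.prod_mem[of I g] at_one.place.hom_prod[of I g]
  by (simp add: positive_at_one_def prod_pos)

section \<open>Exchange relations of rank two seeds\<close>

definition frozen_monomial :: "nat \<Rightarrow> (nat \<Rightarrow> int) \<Rightarrow> ratfun" where
  "frozen_monomial f v = (\<Prod>j=1..f. rvar (j + 2) ^ nat (v (j + 2)))"

lemma positive_frozen_monomial: "positive_at_one (frozen_monomial f v)"
  unfolding frozen_monomial_def
  by (intro positive_at_one_prod positive_at_one_power positive_at_one_rvar)

text \<open>
  Under mutation at \<open>k\<close>, the frozen part of the other column changes from \<open>w\<close> to
  \<open>w' = w - d [u]\<^sub>+\<close> (up to a common sign), where \<open>\<plusminus>u\<close> is the frozen part of column \<open>k\<close>. The identity
  below is \<open>[w']\<^sub>+ + [-w]\<^sub>+ + d [u]\<^sub>+ = [-w']\<^sub>+ + [w]\<^sub>+\<close> written multiplicatively; it is the relation between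
  the coefficients of consecutive exchange relations that makes the variable
  \<open>y''\<close> of \<open>fourth_variable_formula\<close> a polynomial in the previous ones.
\<close>

lemma frozen_monomial_tropical:
  assumes "\<And>j. j > 2 \<Longrightarrow> w' j = w j - int d * max (u j) 0"
  shows "frozen_monomial f w' * frozen_monomial f (\<lambda>i. - w i) * frozen_monomial f u ^ d
    = frozen_monomial f (\<lambda>i. - w' i) * frozen_monomial f w"
proof -
  have "nat (w' j) + nat (- w j) + nat (u j) * d = nat (- w' j) + nat (w j)" if "j > 2" for j
  proof -
    have "int (nat (u j) * d) = int d * max (u j) 0" by (simp add: max_def)
    then show ?thesis using assms[OF that] by linarith
  qed
  then show ?thesis
    unfolding frozen_monomial_def prod.distrib[symmetric] prod_power_distrib
      power_mult[symmetric] power_add[symmetric] by simp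
qed

text \<open>
  The invariant that all seeds of a \<open>(b, c)\<close>-type algebra share. The number \<open>d k\<close> is the exponent of
  the other mutable variable in the exchange relation at \<open>k\<close>; the sign \<open>\<epsilon>\<close> flips with every mutation.
\<close>

definition rank2_seed :: "(nat \<Rightarrow> nat) \<Rightarrow> nat \<Rightarrow> seed \<Rightarrow> bool" where
  "rank2_seed d f s \<longleftrightarrow>
     (\<forall>i\<in>{3..f+2}. fst s i = rvar i) \<and> (\<forall>i\<in>{1,2}. positive_at_one (fst s i)) \<and>
     (\<forall>i\<in>{1,2}. snd s i i = 0) \<and>
     (\<exists>\<epsilon>\<in>{1,-1}. snd s 2 1 = \<epsilon> * int (d 1) \<and> snd s 1 2 = - \<epsilon> * int (d 2))"

text \<open>
  Everything below is symmetric in the two mutable directions. It is therefore stated for \<open>k\<close> and \<open>l\<close>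
  with \<open>{k, l} = {1, 2}\<close>, so that each argument is made once and yields both halves of the theorem.
\<close>

lemma rank2_seed_sign:
  assumes "rank2_seed d f s" "{k, l} = {1, 2}"
  obtains \<epsilon> where "\<epsilon> \<in> {1, -1}" "snd s l k = \<epsilon> * int (d k)" "snd s k l = - \<epsilon> * int (d l)"
proof -
  obtain \<epsilon> :: int where e: "\<epsilon> \<in> {1, -1}" "snd s 2 1 = \<epsilon> * int (d 1)" "snd s 1 2 = - \<epsilon> * int (d 2)"
    using assms(1) unfolding rank2_seed_def by blast
  consider "k = 1" "l = 2" | "k = 2" "l = 1" using assms(2) by (auto simp: doubleton_eq_iff)
  then show thesis
  proof cases
    case 1
    with e that show ?thesis by blast
  next
    case 2
    have "- \<epsilon> \<in> {1, -1}" using e by auto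
    with e 2 that[of "- \<epsilon>"] show ?thesis by simp
  qed
qed

lemma rank2_seed_exchange:
  assumes "rank2_seed d f s" "{k, l} = {1, 2}"
    and "\<epsilon> \<in> {1, -1}" "snd s l k = \<epsilon> * int (d k)"
  shows "mutate_var (2 + f) k s =
    (frozen_monomial f (\<lambda>i. \<epsilon> * snd s i k) * fst s l ^ d k
      + frozen_monomial f (\<lambda>i. - \<epsilon> * snd s i k)) / fst s k"
proof -
  have split: "prod g {1..2 + f} = g k * g l * (\<Prod>j=1..f. g (j + 2))" for g :: "nat \<Rightarrow> ratfun"
    using assms(2) prod_bc_seed_split[of g f] by (auto simp: doubleton_eq_iff mult.commute)
  have k: "snd s k k = 0" using assms(1,2) by (auto simp: rank2_seed_def doubleton_eq_iff)
  have "(\<Prod>j=1..f. fst s (j + 2) ^ nat (v (j + 2))) = frozen_monomial f v" for v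
    unfolding frozen_monomial_def using assms(1) by (intro prod.cong) (auto simp: rank2_seed_def)
  note frozen = this[of "\<lambda>i. snd s i k"] this[of "\<lambda>i. - snd s i k"]
  show ?thesis
    unfolding mutate_var_def case_prod_beta split frozen k assms(4) using assms(3)
    by (auto simp: mult.commute add.commute)
qed

lemma rank2_seed_mutate_var_positive:
  assumes "rank2_seed d f s" "k \<in> {1, 2}"
  shows "positive_at_one (mutate_var (2 + f) k s)"
proof -
  define l where "l = 3 - k"
  have kl: "{k, l} = {1, 2}" using assms(2) by (auto simp: l_def)
  obtain \<epsilon> where e: "\<epsilon> \<in> {1, -1}" "snd s l k = \<epsilon> * int (d k)"
    using rank2_seed_sign[OF assms(1) kl] by blast
  have "positive_at_one (fst s k)" "positive_at_one (fst s l)"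
    using assms(1) kl by (auto simp: rank2_seed_def doubleton_eq_iff)
  then show ?thesis
    unfolding rank2_seed_exchange[OF assms(1) kl e]
    by (intro positive_at_one_divide positive_at_one_add positive_at_one_mult
        positive_at_one_power positive_frozen_monomial)
qed

lemma rank2_seed_mutate:
  assumes "rank2_seed d f s" "k \<in> {1, 2}"
  shows "rank2_seed d f (mutate (2 + f) k s)"
proof -
  have pos: "positive_at_one (mutate_var (2 + f) k s)"
    by (rule rank2_seed_mutate_var_positive[OF assms])
  obtain \<epsilon> where e: "\<epsilon> \<in> {1, -1}" "snd s 2 1 = \<epsilon> * int (d 1)" "snd s 1 2 = - \<epsilon> * int (d 2)"
    using assms(1) unfolding rank2_seed_def by blast
  show ?thesis
    unfolding rank2_seed_def
  proof (intro conjI bexI[of _ "- \<epsilon>"])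
    show "\<forall>i\<in>{3..f + 2}. fst (mutate (2 + f) k s) i = rvar i"
      "\<forall>i\<in>{1, 2}. positive_at_one (fst (mutate (2 + f) k s) i)"
      using assms pos by (auto simp: rank2_seed_def mutate_def)
    show "\<forall>i\<in>{1, 2}. snd (mutate (2 + f) k s) i i = 0"
      using assms(1,2) e by (auto simp: rank2_seed_def mutate_def mutate_matrix_def)
  qed (use assms(2) e in \<open>auto simp: mutate_def mutate_matrix_def\<close>)
qed

lemma mutate_var_involution:
  assumes "rank2_seed d f s" "k \<in> {1, 2}"
  shows "mutate_var (2 + f) k (mutate (2 + f) k s) = fst s k"
proof -
  define l where "l = 3 - k"
  have kl: "{k, l} = {1, 2}" "k \<noteq> l" using assms(2) by (auto simp: l_def)
  obtain \<epsilon> where e: "\<epsilon> \<in> {1, -1}" "snd s l k = \<epsilon> * int (d k)"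
    using rank2_seed_sign[OF assms(1) kl(1)] by blast
  define num where "num = frozen_monomial f (\<lambda>i. \<epsilon> * snd s i k) * fst s l ^ d k
      + frozen_monomial f (\<lambda>i. - \<epsilon> * snd s i k)"
  have x': "mutate_var (2 + f) k s = num / fst s k"
    unfolding num_def by (rule rank2_seed_exchange[OF assms(1) kl(1) e])
  \<comment> \<open>Column \<open>k\<close> and \<open>\<epsilon>\<close> both change sign, so the numerator stays the same.\<close>
  have e': "- \<epsilon> \<in> {1, -1}" "snd (mutate (2 + f) k s) l k = - \<epsilon> * int (d k)"
    using e by (auto simp: mutate_def mutate_matrix_def)
  have "mutate_var (2 + f) k (mutate (2 + f) k s) = num / mutate_var (2 + f) k s"
    using rank2_seed_exchange[OF rank2_seed_mutate[OF assms] kl(1) e'] kl(2)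
    by (simp add: num_def mutate_def mutate_matrix_def)
  moreover have "num / fst s k \<noteq> 0"
    using positive_at_one_nonzero[OF rank2_seed_mutate_var_positive[OF assms]] by (simp only: x' not_False_eq_True)
  ultimately show ?thesis by (simp only: x') simp
qed

text \<open>
  Starting from a cluster \<open>x, y\<close> with neighbours \<open>x'\<close> (replacing \<open>x\<close>) and \<open>y'\<close> (replacing \<open>y\<close>), the variable
  \<open>y''\<close> which replaces \<open>y\<close> in the cluster \<open>x', y\<close> is a polynomial in \<open>x, y, x', y'\<close> with coefficients that
  are Laurent monomials in the frozen variables. The reason: modulo \<open>y\<close>, the relation for \<open>x x'\<close> gives
  \<open>x\<^sup>m x'\<^sup>m \<equiv> C\<^sup>m\<close> and the relation for \<open>y y'\<close> gives \<open>A\<^sub>2 x\<^sup>m \<equiv> - C\<^sub>2\<close>. Together they give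
  \<open>C\<^sub>2 x'\<^sup>m + A\<^sub>2 C\<^sup>m \<equiv> 0\<close>, and the hypothesis \<open>coeff\<close> says that \<open>y y''\<close> is a unit times the left-hand side.
  Keeping track of the quotients by \<open>y\<close> leads to the explicit formula; the sum in it is
  \<open>((A y\<^sup>n + C)\<^sup>m - C\<^sup>m) / (A y\<^sup>n)\<close>.
\<close>

lemma fourth_variable_formula:
  fixes x y x' y' y'' A C A\<^sub>2 C\<^sub>2 A' C' :: "'a::field"
  assumes "y \<noteq> 0" "C\<^sub>2 \<noteq> 0" "n > 0"
    and xx': "x * x' = A * y ^ n + C"
    and yy': "y * y' = A\<^sub>2 * x ^ m + C\<^sub>2"
    and yy'': "y * y'' = A' * x' ^ m + C'"
    and coeff: "A' * A\<^sub>2 * C ^ m = C' * C\<^sub>2"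
  shows "y'' = A' * inverse C\<^sub>2 * (x' ^ m * y' - A\<^sub>2 * (A * y ^ (n - 1) *
           (\<Sum>i<m. C ^ (m - Suc i) * (A * y ^ n + C) ^ i)))"
proof -
  define S where "S = (\<Sum>i<m. C ^ (m - Suc i) * (A * y ^ n + C) ^ i)"
  have yn: "y ^ n = y * y ^ (n - 1)" using assms(3) by (simp add: power_eq_if)
  have xm: "x' ^ m * x ^ m = C ^ m + y * (A * y ^ (n - 1) * S)"
  proof -
    have "x' ^ m * x ^ m = (A * y ^ n + C) ^ m"
      by (simp add: xx' power_mult_distrib[symmetric] mult.commute[of x'])
    also have "\<dots> = C ^ m + (A * y ^ n) * S"
      using power_diff_sumr2[of "A * y ^ n + C" m C] by (simp add: S_def algebra_simps)
    finally show ?thesis by (simp add: yn algebra_simps)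
  qed
  have "y * (x' ^ m * y' - A\<^sub>2 * (A * y ^ (n - 1) * S))
      = x' ^ m * (y * y') - A\<^sub>2 * (y * (A * y ^ (n - 1) * S))"
    by (simp add: algebra_simps)
  also have "\<dots> = A\<^sub>2 * (x' ^ m * x ^ m) + C\<^sub>2 * x' ^ m - A\<^sub>2 * (y * (A * y ^ (n - 1) * S))"
    unfolding yy' by (simp add: algebra_simps)
  also have "\<dots> = C\<^sub>2 * x' ^ m + A\<^sub>2 * C ^ m"
    unfolding xm by (simp add: algebra_simps)
  finally have "A' * inverse C\<^sub>2 * (y * (x' ^ m * y' - A\<^sub>2 * (A * y ^ (n - 1) * S)))
      = inverse C\<^sub>2 * (C\<^sub>2 * A' * x' ^ m + A' * A\<^sub>2 * C ^ m)"
    by (simp add: algebra_simps)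
  also have "\<dots> = y * y''"
    unfolding coeff yy'' using assms(2) by (simp add: field_simps)
  finally have "y * y'' = y * (A' * inverse C\<^sub>2 * (x' ^ m * y' - A\<^sub>2 * (A * y ^ (n - 1) * S)))"
    by (simp only: ac_simps)
  then show ?thesis using assms(1) unfolding S_def[symmetric] by (metis mult_left_cancel)
qed

lemma rank2_seed_fourth_variable:
  assumes s: "rank2_seed d f s" and kl: "{k, l} = {1, 2}" and d: "d k > 0"
  obtains A C A\<^sub>2 C\<^sub>2 A' where
    "A \<in> range (frozen_monomial f)" "C \<in> range (frozen_monomial f)"
    "A\<^sub>2 \<in> range (frozen_monomial f)" "C\<^sub>2 \<in> range (frozen_monomial f)"
    "A' \<in> range (frozen_monomial f)"
    "mutate_var (2 + f) l (mutate (2 + f) k s) = A' * inverse C\<^sub>2 *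
      (mutate_var (2 + f) k s ^ d l * mutate_var (2 + f) l s - A\<^sub>2 * (A * fst s l ^ (d k - 1) *
         (\<Sum>i<d l. C ^ (d l - Suc i) * (A * fst s l ^ d k + C) ^ i)))"
proof -
  obtain \<epsilon> where e: "\<epsilon> \<in> {1, -1}" "snd s l k = \<epsilon> * int (d k)" "snd s k l = - \<epsilon> * int (d l)"
    using rank2_seed_sign[OF s kl] by blast
  have "k \<in> {1, 2}" "k \<noteq> l" and lk: "{l, k} = {1, 2}" using kl by (auto simp: doubleton_eq_iff)
  have nz: "fst s k \<noteq> 0" "fst s l \<noteq> 0"
    using s kl positive_at_one_nonzero by (auto simp: rank2_seed_def doubleton_eq_iff)
  let ?s' = "mutate (2 + f) k s"
  have s': "rank2_seed d f ?s'" by (rule rank2_seed_mutate[OF s \<open>k \<in> {1, 2}\<close>])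
  \<comment> \<open>The sign \<open>\<epsilon>\<close> normalises the columns, so that both signs are covered by one computation.\<close>
  define w w' u where "w = (\<lambda>i. \<epsilon> * snd s i l)" and "w' = (\<lambda>i. \<epsilon> * snd ?s' i l)"
    and "u = (\<lambda>i. - \<epsilon> * snd s i k)"
  have e_l: "- \<epsilon> \<in> {1, -1}" "snd s k l = - \<epsilon> * int (d l)" using e by auto
  have e': "\<epsilon> \<in> {1, -1}" "snd ?s' k l = \<epsilon> * int (d l)"
    using e by (auto simp: mutate_def mutate_matrix_def)
  have x: "fst s k * mutate_var (2 + f) k s
      = frozen_monomial f (\<lambda>i. \<epsilon> * snd s i k) * fst s l ^ d k + frozen_monomial f u"
    using rank2_seed_exchange[OF s kl e(1,2)] nz by (simp add: u_def)
  have y: "fst s l * mutate_var (2 + f) l s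
      = frozen_monomial f (\<lambda>i. - w i) * fst s k ^ d l + frozen_monomial f w"
    using rank2_seed_exchange[OF s lk e_l] nz by (simp add: w_def)
  have y': "fst s l * mutate_var (2 + f) l ?s'
      = frozen_monomial f w' * mutate_var (2 + f) k s ^ d l + frozen_monomial f (\<lambda>i. - w' i)"
    using rank2_seed_exchange[OF s' lk e'] nz \<open>k \<noteq> l\<close> by (simp add: w'_def mutate_def)
  have "frozen_monomial f w' * frozen_monomial f (\<lambda>i. - w i) * frozen_monomial f u ^ d l
      = frozen_monomial f (\<lambda>i. - w' i) * frozen_monomial f w"
  proof (rule frozen_monomial_tropical)
    fix j :: nat assume "j > 2"
    then have "j \<noteq> k" using \<open>k \<in> {1, 2}\<close> by auto
    then show "w' j = w j - int (d l) * max (u j) 0"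
      using e \<open>k \<noteq> l\<close>
      by (auto simp: w_def w'_def u_def mutate_def mutate_matrix_def max_def)
  qed
  note formula = fourth_variable_formula[OF nz(2) _ d x y y' this]
  show thesis
    by (rule that[OF _ _ _ _ _ formula])
      (auto simp: positive_at_one_nonzero[OF positive_frozen_monomial])
qed

section \<open>Generators of the algebra and propagation of zeros\<close>

lemma frozen_monomial_mem:
  assumes "hom_on_subring R p"
    and "\<And>i. i \<in> {3..f+2} \<Longrightarrow> rvar i \<in> R \<and> inverse (rvar i) \<in> R"
  shows "frozen_monomial f v \<in> R" "inverse (frozen_monomial f v) \<in> R" "p (frozen_monomial f v) \<noteq> 0"
proof -
  interpret hom_on_subring R p by fact
  show *: "frozen_monomial f v \<in> R"
    unfolding frozen_monomial_def using assms(2) by (intro prod_mem power_mem) auto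
  have "inverse (frozen_monomial f v) = (\<Prod>j=1..f. inverse (rvar (j + 2)) ^ nat (v (j + 2)))"
    by (simp add: frozen_monomial_def prod_inversef[symmetric] power_inverse)
  also have "\<dots> \<in> R"
    using assms(2) by (intro prod_mem power_mem) auto
  finally show "inverse (frozen_monomial f v) \<in> R" .
  with * show "p (frozen_monomial f v) \<noteq> 0"
    by (rule hom_inverse(1)) (rule positive_at_one_nonzero[OF positive_frozen_monomial])
qed

lemma fourth_variable_mem:
  assumes R: "hom_on_subring R p"
    and frozen: "\<And>i. i \<in> {3..f+2} \<Longrightarrow> rvar i \<in> R \<and> inverse (rvar i) \<in> R"
    and s: "rank2_seed d f s" and kl: "{k, l} = {1, 2}" and d: "d k > 0"
    and mem: "\<And>i. i \<in> {1, 2} \<Longrightarrow> fst s i \<in> R \<and> mutate_var (2 + f) i s \<in> R"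
  shows "mutate_var (2 + f) l (mutate (2 + f) k s) \<in> R"
proof -
  interpret hom_on_subring R p by fact
  note M = frozen_monomial_mem(1,2)[OF R frozen]
  have kl': "k \<in> {1, 2}" "l \<in> {1, 2}" using kl by auto
  obtain A C A\<^sub>2 C\<^sub>2 A' where
    F: "A \<in> range (frozen_monomial f)" "C \<in> range (frozen_monomial f)"
    "A\<^sub>2 \<in> range (frozen_monomial f)" "C\<^sub>2 \<in> range (frozen_monomial f)"
    "A' \<in> range (frozen_monomial f)"
    and eq: "mutate_var (2 + f) l (mutate (2 + f) k s) = A' * inverse C\<^sub>2 *
      (mutate_var (2 + f) k s ^ d l * mutate_var (2 + f) l s - A\<^sub>2 * (A * fst s l ^ (d k - 1) *
         (\<Sum>i<d l. C ^ (d l - Suc i) * (A * fst s l ^ d k + C) ^ i)))"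
    using rank2_seed_fourth_variable[OF s kl d] by blast
  show ?thesis
    unfolding eq using F M mem kl'
    by (intro mult_mem diff_mem power_mem sum_mem add_mem) auto
qed

text \<open>
  This is where the assumption on \<open>b\<close>, \<open>c\<close> and the characteristic comes from. If \<open>y\<close> and \<open>y'\<close> are sent to
  \<open>0\<close>, all that is left of \<open>fourth_variable_formula\<close> is the term containing \<open>y\<^sup>n\<^sup>-\<^sup>1\<close> times a sum of \<open>m\<close>
  equal powers of \<open>C\<close>. Up to units this is \<open>0\<^sup>n\<^sup>-\<^sup>1 m\<close>, where \<open>n = d k\<close> and \<open>m = d l\<close>.
\<close>

lemma fourth_variable_at_zeros:
  assumes R: "hom_on_subring R (p :: ratfun \<Rightarrow> 'k::field)"
    and frozen: "\<And>i. i \<in> {3..f+2} \<Longrightarrow> rvar i \<in> R \<and> inverse (rvar i) \<in> R"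
    and s: "rank2_seed d f s" and kl: "{k, l} = {1, 2}" and d: "d k > 0"
    and mem: "\<And>i. i \<in> {1, 2} \<Longrightarrow> fst s i \<in> R \<and> mutate_var (2 + f) i s \<in> R"
    and zero: "p (fst s l) = 0" "p (mutate_var (2 + f) l s) = 0"
  shows "p (mutate_var (2 + f) l (mutate (2 + f) k s)) = 0 \<longleftrightarrow> d k > 1 \<or> of_nat (d l) = (0::'k)"
proof -
  interpret hom_on_subring R p by fact
  note M = frozen_monomial_mem[OF R frozen]
  have kl': "k \<in> {1, 2}" "l \<in> {1, 2}" using kl by auto
  obtain A C A\<^sub>2 C\<^sub>2 A' where
    F: "A \<in> range (frozen_monomial f)" "C \<in> range (frozen_monomial f)"
    "A\<^sub>2 \<in> range (frozen_monomial f)" "C\<^sub>2 \<in> range (frozen_monomial f)"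
    "A' \<in> range (frozen_monomial f)"
    and eq: "mutate_var (2 + f) l (mutate (2 + f) k s) = A' * inverse C\<^sub>2 *
      (mutate_var (2 + f) k s ^ d l * mutate_var (2 + f) l s - A\<^sub>2 * (A * fst s l ^ (d k - 1) *
         (\<Sum>i<d l. C ^ (d l - Suc i) * (A * fst s l ^ d k + C) ^ i)))"
    using rank2_seed_fourth_variable[OF s kl d] by blast
  have FR: "A \<in> R" "C \<in> R" "A\<^sub>2 \<in> R" "C\<^sub>2 \<in> R" "A' \<in> R" "inverse C\<^sub>2 \<in> R" using F M by auto
  have nz: "p A \<noteq> 0" "p C \<noteq> 0" "p A\<^sub>2 \<noteq> 0" "p A' \<noteq> 0" using F M(3) by auto
  have "C\<^sub>2 \<noteq> 0" using F positive_at_one_nonzero[OF positive_frozen_monomial] by auto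
  then have nz': "p (inverse C\<^sub>2) \<noteq> 0"
    using hom_inverse(1)[of "inverse C\<^sub>2"] FR by simp
  have x: "fst s l \<in> R" "mutate_var (2 + f) k s \<in> R" "mutate_var (2 + f) l s \<in> R"
    using mem kl' by auto
  let ?S = "\<Sum>i<d l. C ^ (d l - Suc i) * (A * fst s l ^ d k + C) ^ i"
  have SR: "?S \<in> R" using FR x by (intro sum_mem mult_mem power_mem add_mem)
  have dk0: "0 ^ d k = (0::'k)" using d by simp
  have "p ?S = (\<Sum>i<d l. p (C ^ (d l - Suc i) * (A * fst s l ^ d k + C) ^ i))"
    using FR x by (intro hom_sum mult_mem power_mem add_mem)
  also have "\<dots> = (\<Sum>i<d l. p C ^ (d l - 1))"
  proof (rule sum.cong[OF refl])
    fix i assume i: "i \<in> {..<d l}"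
    have "p (C ^ (d l - Suc i) * (A * fst s l ^ d k + C) ^ i) = p C ^ (d l - Suc i) * p C ^ i"
      using FR x zero d by (simp add: zero_power hom_mult hom_power hom_add mult_mem power_mem add_mem)
    then show "p (C ^ (d l - Suc i) * (A * fst s l ^ d k + C) ^ i) = p C ^ (d l - 1)"
      using i by (simp flip: power_add)
  qed
  finally have S: "p ?S = of_nat (d l) * p C ^ (d l - 1)" by simp
  have "p (mutate_var (2 + f) l (mutate (2 + f) k s)) = - (p A' * p (inverse C\<^sub>2) *
      (p A\<^sub>2 * (p A * 0 ^ (d k - 1) * (of_nat (d l) * p C ^ (d l - 1)))))"
    unfolding eq S[symmetric] using FR SR x zero
    by (simp add: hom_mult hom_power hom_diff mult_mem power_mem diff_mem)
  then show ?thesis using nz nz' d by (auto simp: power_0_left)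
qed

text \<open>
  A subring that contains a cluster, its two neighbouring variables and the frozen variables with
  their inverses has the same property for each adjacent cluster: one of the two new neighbours is
  the variable that was just exchanged, the other one is a fourth variable.
\<close>

lemma reachable_seeds_mem:
  assumes R: "hom_on_subring R p"
    and frozen: "\<And>i. i \<in> {3..f+2} \<Longrightarrow> rvar i \<in> R \<and> inverse (rvar i) \<in> R"
    and s0: "rank2_seed d f s0" and d: "d 1 > 0" "d 2 > 0"
    and mem: "\<And>i. i \<in> {1, 2} \<Longrightarrow> fst s0 i \<in> R \<and> mutate_var (2 + f) i s0 \<in> R"
    and s: "s \<in> reachable_seeds 2 f s0"
  shows "rank2_seed d f s \<and> (\<forall>i\<in>{1, 2}. fst s i \<in> R \<and> mutate_var (2 + f) i s \<in> R)"
  using s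
proof induction
  case init
  then show ?case using s0 mem by blast
next
  case (step s k)
  define l where "l = 3 - k"
  consider "k = 1" "l = 2" | "k = 2" "l = 1" using step(2) unfolding l_def by fastforce
  then have kl: "{k, l} = {1, 2}" "k \<in> {1, 2}" "k \<noteq> l" "d k > 0"
    using d by (cases; simp add: insert_commute)+
  have s: "rank2_seed d f s" "\<And>i. i \<in> {1, 2} \<Longrightarrow> fst s i \<in> R \<and> mutate_var (2 + f) i s \<in> R"
    using step by auto
  have "mutate_var (2 + f) l (mutate (2 + f) k s) \<in> R"
    by (rule fourth_variable_mem[OF R frozen s(1) kl(1,4) s(2)])
  moreover have "mutate_var (2 + f) k (mutate (2 + f) k s) \<in> R"
    using s(2)[OF kl(2)] by (simp only: mutate_var_involution[OF s(1) kl(2)])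
  moreover have "fst (mutate (2 + f) k s) i \<in> R" if "i \<in> {1, 2}" for i
    using s(2) that kl(2) by (auto simp: mutate_def)
  ultimately have "fst (mutate (2 + f) k s) i \<in> R \<and> mutate_var (2 + f) i (mutate (2 + f) k s) \<in> R"
    if "i \<in> {k, l}" for i
    using that kl(1) by blast
  then show ?case
    using rank2_seed_mutate[OF s(1) kl(2)] kl(1) by simp
qed

text \<open>
  The cluster algebra is generated by the initial cluster, its two neighbouring variables and the
  frozen variables with their inverses, expressed as minimality among subrings.
\<close>

lemma rank2_cluster_algebra_subset:
  assumes R: "hom_on_subring R p"
    and frozen: "\<And>i. i \<in> {3..f+2} \<Longrightarrow> rvar i \<in> R \<and> inverse (rvar i) \<in> R"
    and s0: "rank2_seed d f s0" and d: "d 1 > 0" "d 2 > 0"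
    and mem: "\<And>i. i \<in> {1, 2} \<Longrightarrow> fst s0 i \<in> R \<and> mutate_var (2 + f) i s0 \<in> R"
  shows "carrier (cluster_algebra 2 f s0) \<subseteq> R"
proof (rule cluster_algebra_subset[OF R])
  fix s i assume s: "s \<in> reachable_seeds 2 f s0" and i: "i \<in> {1..2 + f}"
  have "i \<in> {1, 2} \<or> i \<in> {3..f+2}" using i by auto
  then show "fst s i \<in> R"
    using reachable_seeds_mem[OF R frozen s0 d mem s] frozen by (auto simp: rank2_seed_def)
next
  fix i assume "i \<in> {2 + 1..2 + f}"
  then show "inverse (fst s0 i) \<in> R" using s0 frozen[of i] by (auto simp: rank2_seed_def)
qed

text \<open>
  Zeros propagate in the same way as membership. Requiring \<open>0\<close> at the variable in position \<open>l\<close> and at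
  its exchange partner makes the property stable: mutation at \<open>l\<close> swaps the two, and
  mutation at \<open>k\<close> produces a partner that vanishes by \<open>fourth_variable_at_zeros\<close>.
\<close>

lemma reachable_zeros:
  assumes R: "hom_on_subring R (p :: ratfun \<Rightarrow> 'k::field)"
    and frozen: "\<And>i. i \<in> {3..f+2} \<Longrightarrow> rvar i \<in> R \<and> inverse (rvar i) \<in> R"
    and s0: "rank2_seed d f s0" and d: "d 1 > 0" "d 2 > 0"
    and mem: "\<And>i. i \<in> {1, 2} \<Longrightarrow> fst s0 i \<in> R \<and> mutate_var (2 + f) i s0 \<in> R"
    and kl: "{k, l} = {1, 2}" and cond: "d k > 1 \<or> of_nat (d l) = (0::'k)"
    and zero: "p (fst s0 l) = 0" "p (mutate_var (2 + f) l s0) = 0"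
    and s: "s \<in> reachable_seeds 2 f s0"
  shows "p (fst s l) = 0 \<and> p (mutate_var (2 + f) l s) = 0"
  using s
proof induction
  case init
  then show ?case using zero by blast
next
  case (step s k')
  have s: "rank2_seed d f s" "\<And>i. i \<in> {1, 2} \<Longrightarrow> fst s i \<in> R \<and> mutate_var (2 + f) i s \<in> R"
    using reachable_seeds_mem[OF R frozen s0 d mem step(1)] by auto
  have dk: "d k > 0" using d kl by (auto simp: doubleton_eq_iff)
  have lk: "l \<noteq> k" "l \<in> {1, 2}" using kl by (auto simp: doubleton_eq_iff)
  consider "k' = k" | "k' = l" using step(2) kl by (fastforce simp: doubleton_eq_iff)
  then show ?case
  proof cases
    case 1
    then show ?thesis
      using fourth_variable_at_zeros[OF R frozen s(1) kl dk s(2)] step.IH cond lk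
      by (auto simp: mutate_def)
  next
    case 2
    then show ?thesis
      using mutate_var_involution[OF s(1) lk(2)] step.IH by (simp add: mutate_def)
  qed
qed

section \<open>The initial seed\<close>

text \<open>
  The data attached to the direction \<open>i\<close> of the initial seed. The column of \<open>x\<^sub>1\<close> carries \<open>c\<close> and \<open>e2\<close>, the
  column of \<open>x\<^sub>2\<close> carries \<open>b\<close> and \<open>e1\<close>.
\<close>

definition bc_degree :: "nat \<Rightarrow> nat \<Rightarrow> nat \<Rightarrow> nat" where
  "bc_degree b c i = (if i = 1 then c else b)"

definition bc_vec :: "(nat \<Rightarrow> int) \<Rightarrow> (nat \<Rightarrow> int) \<Rightarrow> nat \<Rightarrow> nat \<Rightarrow> int" where
  "bc_vec e1 e2 i = (if i = 1 then e2 else e1)"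

lemma rank2_seed_bc: "rank2_seed (bc_degree b c) f (bc_seed b c f e1 e2)"
  unfolding rank2_seed_def
  by (intro conjI bexI[of _ "-1"])
    (auto simp: bc_seed_def bc_matrix_def bc_degree_def positive_at_one_rvar)

lemma bc_exchange:
  assumes "{k, l} = {1, 2}"
  shows "rvar k * mutate_var (2 + f) k (bc_seed b c f e1 e2) =
    vec_power f bc_y (vec_pos (bc_vec e1 e2 k)) * rvar l ^ bc_degree b c k
      + vec_power f bc_y (vec_neg (bc_vec e1 e2 k))"
  using bc_exchange_relations[of b c f e1 e2] assms
  by (auto simp: bc_degree_def bc_vec_def bc_x0_def bc_x1_def bc_x2_def bc_x3_def
      doubleton_eq_iff mult.commute)

lemma vec_power_nonzero:
  "(\<And>j. j \<in> {1..f} \<Longrightarrow> \<beta> j \<noteq> 0) \<Longrightarrow> vec_power f \<beta> v \<noteq> 0"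
  by (simp add: vec_power_def)

lemma vec_power_pos_times_inverse:
  assumes "\<And>j. j \<in> {1..f} \<Longrightarrow> \<beta> j \<noteq> 0"
  shows "vec_power f \<beta> (vec_pos e) * vec_power f \<beta> (\<lambda>j. - e j) = vec_power f \<beta> (vec_neg e)"
proof -
  have "\<beta> j powi vec_pos e j * \<beta> j powi (- e j) = \<beta> j powi vec_neg e j" if "j \<in> {1..f}" for j
  proof -
    have "vec_pos e j + - e j = vec_neg e j" by (simp add: vec_pos_def vec_neg_def max_def)
    moreover have "\<beta> j powi (vec_pos e j + - e j) = \<beta> j powi vec_pos e j * \<beta> j powi (- e j)"
      by (rule power_int_add) (use assms[OF that] in simp)
    ultimately show ?thesis by (simp only:)
  qed
  then show ?thesis
    unfolding vec_power_def prod.distrib[symmetric] by (intro prod.cong) auto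
qed

text \<open>
  The equation on \<open>\<alpha>\<close> and \<open>\<beta>\<close> is the vanishing of the right-hand side of an initial exchange
  relation, divided by the unit \<open>\<beta>\<close> to the power \<open>[e]\<^sub>+\<close>.
\<close>

lemma deep_equation_iff:
  assumes "\<And>j. j \<in> {1..f} \<Longrightarrow> \<beta> j \<noteq> 0"
  shows "\<alpha> ^ d + vec_power f \<beta> (\<lambda>j. - e j) = 0 \<longleftrightarrow>
    vec_power f \<beta> (vec_pos e) * \<alpha> ^ d + vec_power f \<beta> (vec_neg e) = 0"
proof -
  have "vec_power f \<beta> (vec_pos e) * \<alpha> ^ d + vec_power f \<beta> (vec_neg e)
      = vec_power f \<beta> (vec_pos e) * (\<alpha> ^ d + vec_power f \<beta> (\<lambda>j. - e j))"
    unfolding distrib_left using vec_power_pos_times_inverse[of f \<beta> e] assms by metis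
  then show ?thesis using vec_power_nonzero[of f \<beta> "vec_pos e"] assms by simp
qed

section \<open>Points that vanish on every other cluster variable\<close>

text \<open>
  The values in the theorem, stated for either direction: \<open>l\<close> is the position of the initial variable that
  is sent to \<open>0\<close>, and \<open>k\<close> the position of the one that is sent to \<open>\<alpha>\<close>.
\<close>

definition vanishing_values ::
  "nat \<Rightarrow> nat \<Rightarrow> nat \<Rightarrow> (nat \<Rightarrow> int) \<Rightarrow> (nat \<Rightarrow> int) \<Rightarrow> nat \<Rightarrow> nat \<Rightarrow> (ratfun \<Rightarrow> 'k::field)
     \<Rightarrow> 'k \<Rightarrow> (nat \<Rightarrow> 'k) \<Rightarrow> bool" where
  "vanishing_values b c f e1 e2 k l p \<alpha> \<beta> \<longleftrightarrow>
     p (mutate_var (2 + f) l (bc_seed b c f e1 e2)) = 0 \<and> p (rvar k) = \<alpha> \<and> p (rvar l) = 0 \<and>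
     p (mutate_var (2 + f) k (bc_seed b c f e1 e2))
       = inverse \<alpha> * vec_power f \<beta> (vec_neg (bc_vec e1 e2 k)) \<and>
     (\<forall>j\<in>{1..f}. p (bc_y j) = \<beta> j)"

lemma has_values_iff:
  "has_values b c f e1 e2 p (0, \<alpha>, 0, inverse \<alpha> * vec_power f \<beta> (vec_neg e2)) \<beta> \<longleftrightarrow>
     vanishing_values b c f e1 e2 1 2 p \<alpha> \<beta>"
  "has_values b c f e1 e2 p (inverse \<alpha> * vec_power f \<beta> (vec_neg e1), 0, \<alpha>, 0) \<beta> \<longleftrightarrow>
     vanishing_values b c f e1 e2 2 1 p \<alpha> \<beta>"
  unfolding has_values_def vanishing_values_def bc_x0_def bc_x1_def bc_x2_def bc_x3_def bc_vec_def
  by auto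

lemma bc_seed_simps: "fst (bc_seed b c f e1 e2) = rvar"
  by (simp add: bc_seed_def)

lemma bc_degree_pos: "b > 0 \<Longrightarrow> c > 0 \<Longrightarrow> bc_degree b c i > 0"
  by (simp add: bc_degree_def)

lemma bc_initial_mem:
  fixes f b c e1 e2
  defines "s0 \<equiv> bc_seed b c f e1 e2" and "A \<equiv> carrier (cluster_algebra 2 f (bc_seed b c f e1 e2))"
  shows "i \<in> {3..f+2} \<Longrightarrow> rvar i \<in> A \<and> inverse (rvar i) \<in> A"
    and "i \<in> {1, 2} \<Longrightarrow> fst s0 i \<in> A \<and> mutate_var (2 + f) i s0 \<in> A"
proof -
  have init: "s0 \<in> reachable_seeds 2 f s0" by (rule reachable_seeds.init)
  note mem = cluster_variable_mem[of _ 2 f s0, folded A_def[folded s0_def]]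
  show "rvar i \<in> A \<and> inverse (rvar i) \<in> A" if "i \<in> {3..f+2}"
    using mem[OF init, of i] inverse_frozen_mem[of i 2 f s0] that
    by (auto simp: A_def s0_def bc_seed_simps)
  show "fst s0 i \<in> A \<and> mutate_var (2 + f) i s0 \<in> A" if "i \<in> {1, 2}"
  proof
    show "fst s0 i \<in> A" using mem[OF init, of i] that by auto
    have "mutate (2 + f) i s0 \<in> reachable_seeds 2 f s0"
      using that by (intro reachable_seeds.step init) auto
    from mem[OF this, of i] show "mutate_var (2 + f) i s0 \<in> A"
      using that by (auto simp: mutate_def)
  qed
qed

lemma cluster_point_values:
  fixes p :: "ratfun \<Rightarrow> 'k::field"
  assumes p: "p \<in> cluster_points 2 f (bc_seed b c f e1 e2)"
  defines "\<beta> \<equiv> \<lambda>j. p (bc_y j)"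
  shows "j \<in> {1..f} \<Longrightarrow> \<beta> j \<noteq> 0"
    and "{k, l} = {1, 2} \<Longrightarrow> p (rvar k) * p (mutate_var (2 + f) k (bc_seed b c f e1 e2)) =
      vec_power f \<beta> (vec_pos (bc_vec e1 e2 k)) * p (rvar l) ^ bc_degree b c k
        + vec_power f \<beta> (vec_neg (bc_vec e1 e2 k))"
proof -
  let ?A = "carrier (cluster_algebra 2 f (bc_seed b c f e1 e2))"
  interpret hom_on_subring ?A p using p by (simp add: cluster_points_iff)
  note frozen = bc_initial_mem(1)[of _ f b c e1 e2] and mem = bc_initial_mem(2)[of _ b c f e1 e2]
  have yA: "bc_y j \<in> ?A" if "j \<in> {1..f}" for j using frozen[of "2 + j"] that by (simp add: bc_y_def)
  show "\<beta> j \<noteq> 0" if "j \<in> {1..f}"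
    using hom_inverse(1)[of "bc_y j"] frozen[of "2 + j"] rvar_nonzero that
    by (simp add: \<beta>_def bc_y_def)
  have nonneg: "vec_pos v j \<ge> 0" "vec_neg v j \<ge> 0" for v j
    by (simp_all add: vec_pos_def vec_neg_def)
  have Y: "vec_power f bc_y v \<in> ?A" "p (vec_power f bc_y v) = vec_power f \<beta> v"
    if "\<And>j. v j \<ge> 0" for v
    unfolding \<beta>_def using vec_power_mem[of f bc_y v] hom_vec_power[of f bc_y v] yA that by blast+
  assume kl: "{k, l} = {1, 2}"
  then have "k \<in> {1, 2}" "l \<in> {1, 2}" by auto
  then show "p (rvar k) * p (mutate_var (2 + f) k (bc_seed b c f e1 e2)) =
      vec_power f \<beta> (vec_pos (bc_vec e1 e2 k)) * p (rvar l) ^ bc_degree b c k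
        + vec_power f \<beta> (vec_neg (bc_vec e1 e2 k))"
    using arg_cong[OF bc_exchange[OF kl, of f b c e1 e2], of p] mem[of k] mem[of l]
    by (simp add: hom_mult hom_add hom_power mult_mem power_mem Y nonneg bc_seed_simps)
qed

lemma cluster_point_unique:
  fixes p q :: "ratfun \<Rightarrow> 'k::field"
  assumes bc: "b > 0" "c > 0" and kl: "{k, l} = {1, 2}"
    and p: "p \<in> cluster_points 2 f (bc_seed b c f e1 e2)"
    and q: "q \<in> cluster_points 2 f (bc_seed b c f e1 e2)"
    and vp: "vanishing_values b c f e1 e2 k l p \<alpha> \<beta>"
    and vq: "vanishing_values b c f e1 e2 k l q \<alpha> \<beta>"
  shows "q = p"
proof -
  let ?s0 = "bc_seed b c f e1 e2"
  let ?A = "carrier (cluster_algebra 2 f ?s0)"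
  interpret p: hom_on_subring ?A p using p by (simp add: cluster_points_iff)
  interpret q: hom_on_subring ?A q using q by (simp add: cluster_points_iff)
  let ?E = "{x \<in> ?A. p x = q x}"
  have E: "hom_on_subring ?E p" by (rule p.equalizer) (rule q.hom_on_subring_axioms)
  have "?A \<subseteq> ?E"
  proof (rule rank2_cluster_algebra_subset[OF E _ rank2_seed_bc])
    fix i assume i: "i \<in> {3..f+2}"
    then obtain j where j: "i = 2 + j" "j \<in> {1..f}" by (auto dest: le_Suc_ex)
    then have "p (rvar i) = q (rvar i)" using vp vq by (simp add: vanishing_values_def bc_y_def)
    then show "rvar i \<in> ?E \<and> inverse (rvar i) \<in> ?E"
      using bc_initial_mem(1)[OF i, of b c e1 e2] rvar_nonzero[of i]
      by (simp add: p.hom_inverse(2) q.hom_inverse(2))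
  next
    fix i :: nat assume "i \<in> {1, 2}"
    then show "fst ?s0 i \<in> ?E \<and> mutate_var (2 + f) i ?s0 \<in> ?E"
      using bc_initial_mem(2)[of i b c f e1 e2] vp vq kl
      by (auto simp: bc_seed_simps vanishing_values_def doubleton_eq_iff)
  qed (simp_all add: bc_degree_pos bc)
  then show ?thesis
    using p q by (intro extensionalityI[of q ?A p]) (auto simp: cluster_points_iff)
qed

text \<open>
  A point with \<open>x\<^sub>l \<mapsto> 0\<close> cannot be obtained by evaluating Laurent polynomials, since \<open>x\<^sub>l\<close> occurs in
  denominators. Instead \<open>x\<^sub>l\<close> is first sent to an indeterminate \<open>t\<close>, the other variables to constants,
  which gives a homomorphism to the field of rational functions in \<open>t\<close>. The
  equation on \<open>\<alpha>\<close> and \<open>\<beta>\<close> says that the neighbour \<open>x\<^sub>l'\<close> is sent to \<open>0 / t = 0\<close>. So all generators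
  have images without pole at \<open>t = 0\<close>, hence so has the whole cluster algebra, and one may set \<open>t = 0\<close>.
\<close>

lemma cluster_point_exists:
  fixes \<alpha> :: "'k::field"
  assumes bc: "b > 0" "c > 0" and kl: "{k, l} = {1, 2}"
    and par: "deep_parameters (bc_degree b c l) f (bc_vec e1 e2 l) \<alpha> \<beta>"
  obtains p where "p \<in> cluster_points 2 f (bc_seed b c f e1 e2)"
    "vanishing_values b c f e1 e2 k l p \<alpha> \<beta>"
proof -
  let ?s0 = "bc_seed b c f e1 e2"
  let ?A = "carrier (cluster_algebra 2 f ?s0)"
  let ?x' = "\<lambda>i. mutate_var (2 + f) i ?s0"
  define con :: "'k \<Rightarrow> 'k poly fract" where "con a = Fract [:a:] 1" for a
  define t :: "'k poly fract" where "t = Fract [:0, 1:] 1"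
  \<comment> \<open>Values at indices outside \<open>{1..2 + f}\<close> are arbitrary, as these variables do not occur in the seed.\<close>
  define g where "g i = (if i = k then con \<alpha> else if i = l then t else con (\<beta> (i - 2)))" for i
  interpret one: idom_hom_to_field "eval_poly g" by (rule eval_poly_hom)
  interpret two: idom_hom_to_field "\<lambda>P. poly P (0::'k)" by (rule eval_at_zero_hom)
  interpret con: hom_on_subring UNIV con
    by unfold_locales (auto simp: con_def One_fract_def one_pCons mult.commute)
  have t: "t \<in> two.local_ring" "two.place t = 0" "t \<noteq> 0"
    using two.place_of_base[of "[:0, 1:]"] by (auto simp: t_def Zero_fract_def eq_fract)
  have con: "con a \<in> two.local_ring" "two.place (con a) = a" for a
    using two.place_of_base[of "[:a:]"] by (auto simp: con_def)
  define R where "R = {x \<in> one.local_ring. one.place x \<in> two.local_ring}"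
  define p where "p x = two.place (one.place x)" for x
  interpret P: hom_on_subring R p
    unfolding R_def p_def
    by (rule hom_on_subring_compose) unfold_locales
  have inverse_R: "inverse x \<in> R" if "x \<in> R" "p x \<noteq> 0" for x
  proof -
    have x: "one.place x \<noteq> 0" "x \<noteq> 0"
      using that two.place.hom_zero P.hom_zero by (auto simp: p_def)
    then have "inverse x \<in> one.local_ring" using that by (simp add: R_def one.inverse_mem)
    with that x show ?thesis
      by (simp add: R_def p_def one.place.hom_inverse(2) two.inverse_mem)
  qed
  have \<alpha>: "\<alpha> \<noteq> 0" and \<beta>: "\<And>j. j \<in> {1..f} \<Longrightarrow> \<beta> j \<noteq> 0"
    and "\<alpha> ^ bc_degree b c l + vec_power f \<beta> (\<lambda>j. - bc_vec e1 e2 l j) = 0"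
    using par by (auto simp: deep_parameters_def)
  then have eqn: "vec_power f \<beta> (vec_pos (bc_vec e1 e2 l)) * \<alpha> ^ bc_degree b c l
      + vec_power f \<beta> (vec_neg (bc_vec e1 e2 l)) = 0"
    using deep_equation_iff[of f \<beta>] by blast
  have nonneg: "vec_pos v j \<ge> 0" "vec_neg v j \<ge> 0" for v j
    by (simp_all add: vec_pos_def vec_neg_def)
  have kl': "k \<noteq> l" "k \<in> {1, 2}" "l \<in> {1, 2}" using kl by (auto simp: doubleton_eq_iff)
  have rvar_one: "rvar i \<in> one.local_ring" "one.place (rvar i) = g i" for i
    by (rule place_rvar)+
  then have rvar_R: "rvar i \<in> R" for i by (simp add: R_def g_def con t)
  have px: "p (rvar k) = \<alpha>" "p (rvar l) = 0"
    using kl' by (simp_all add: p_def rvar_one g_def con t)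
  have gy: "g (2 + j) = con (\<beta> j)" if "j \<in> {1..f}" for j using kl' that by (auto simp: g_def)
  then have py: "p (bc_y j) = \<beta> j" if "j \<in> {1..f}" for j
    using that by (simp add: bc_y_def p_def rvar_one con)
  have yR: "bc_y j \<in> R" "bc_y j \<in> one.local_ring" for j by (simp_all add: bc_y_def rvar_R rvar_one)
  have pY: "p (vec_power f bc_y v) = vec_power f \<beta> v"
    and YR: "vec_power f bc_y v \<in> R"
    and oneY: "one.place (vec_power f bc_y v) = con (vec_power f \<beta> v)"
    if "\<And>j. v j \<ge> 0" for v
  proof -
    show "vec_power f bc_y v \<in> R" by (rule P.vec_power_mem[OF yR(1) that])
    show "p (vec_power f bc_y v) = vec_power f \<beta> v"
      unfolding P.hom_vec_power[OF yR(1) that] using py by (simp add: vec_power_def)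
    show "one.place (vec_power f bc_y v) = con (vec_power f \<beta> v)"
      unfolding one.place.hom_vec_power[OF yR(2) that] con.hom_vec_power[OF UNIV_I that]
      using gy by (simp add: vec_power_def bc_y_def rvar_one)
  qed
  let ?N = "\<lambda>i j. vec_power f bc_y (vec_pos (bc_vec e1 e2 i)) * rvar j ^ bc_degree b c i
      + vec_power f bc_y (vec_neg (bc_vec e1 e2 i))"
  have NR: "?N i j \<in> R" for i j
    by (intro P.add_mem P.mult_mem P.power_mem YR nonneg rvar_R)
  have x'k: "?x' k = ?N k l * inverse (rvar k)"
    using bc_exchange[OF kl, of f b c e1 e2] rvar_nonzero[of k] by (simp add: field_simps)
  have x'l: "?x' l = ?N l k / rvar l"
    using bc_exchange[of l k f b c e1 e2] rvar_nonzero[of l] kl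
    by (simp add: field_simps insert_commute)
  have inv_k: "inverse (rvar k) \<in> R" using inverse_R rvar_R px \<alpha> by simp
  have x'k_R: "?x' k \<in> R" unfolding x'k by (intro P.mult_mem NR inv_k)
  have "p (?N k l) = vec_power f \<beta> (vec_neg (bc_vec e1 e2 k))"
    using bc_degree_pos[OF bc, of k]
    by (simp add: P.hom_add P.hom_mult P.hom_power P.mult_mem P.power_mem YR rvar_R nonneg pY px
        power_0_left)
  moreover have "p (inverse (rvar k)) = inverse \<alpha>"
    using P.hom_inverse(2)[OF rvar_R inv_k rvar_nonzero] px by simp
  ultimately have px'k: "p (?x' k) = inverse \<alpha> * vec_power f \<beta> (vec_neg (bc_vec e1 e2 k))"
    unfolding x'k P.hom_mult[OF NR inv_k] by (simp add: mult.commute)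
  have Y1: "vec_power f bc_y v \<in> one.local_ring" if "\<And>j. v j \<ge> 0" for v
    using YR[OF that] by (simp add: R_def)
  have "one.place (?N l k) = con (vec_power f \<beta> (vec_pos (bc_vec e1 e2 l)) * \<alpha> ^ bc_degree b c l
      + vec_power f \<beta> (vec_neg (bc_vec e1 e2 l)))"
    by (simp add: one.place.hom_add one.place.hom_mult one.place.hom_power one.place.mult_mem
        one.place.power_mem Y1 rvar_one nonneg oneY con.hom_add con.hom_mult con.hom_power g_def)
  then have N0: "one.place (?N l k) = 0" by (simp only: eqn con.hom_zero)
  have tl: "one.place (rvar l) = t" using kl' by (simp add: rvar_one g_def)
  have N1: "?N l k \<in> one.local_ring" using NR by (simp add: R_def)
  have x'l_one: "?x' l \<in> one.local_ring" "one.place (?x' l) = 0"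
    unfolding x'l using one.divide_mem[OF N1 rvar_one(1)[of l]] tl t N0 by simp_all
  then have x'l_R: "?x' l \<in> R" and px'l: "p (?x' l) = 0"
    by (simp_all add: R_def p_def two.place.zero_mem two.place.hom_zero)
  have AR: "?A \<subseteq> R"
  proof (rule rank2_cluster_algebra_subset[OF P.hom_on_subring_axioms _ rank2_seed_bc])
    fix i assume i: "i \<in> {3..f+2}"
    then obtain j where "i = 2 + j" "j \<in> {1..f}" by (auto dest: le_Suc_ex)
    then have "p (rvar i) \<noteq> 0" using py[of j] \<beta>[of j] by (simp add: bc_y_def)
    then show "rvar i \<in> R \<and> inverse (rvar i) \<in> R" using rvar_R inverse_R by blast
  next
    fix i :: nat assume "i \<in> {1, 2}"
    then show "fst ?s0 i \<in> R \<and> ?x' i \<in> R"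
      using kl x'k_R x'l_R rvar_R by (auto simp: bc_seed_simps doubleton_eq_iff)
  qed (simp_all add: bc_degree_pos bc)
  let ?p = "restrict p ?A"
  have "hom_on_subring ?A ?p"
    by (rule P.restrict_hom[OF AR]) (simp_all add: cluster_algebra_closed)
  then have "?p \<in> cluster_points 2 f ?s0" by (simp add: cluster_points_iff)
  moreover have "vanishing_values b c f e1 e2 k l ?p \<alpha> \<beta>"
    using bc_initial_mem(2)[of k b c f e1 e2] bc_initial_mem(2)[of l b c f e1 e2] kl'
      bc_initial_mem(1)[of "2 + _" f b c e1 e2] px py px'k px'l
    by (auto simp: vanishing_values_def bc_seed_simps bc_y_def)
  ultimately show thesis by (rule that)
qed

lemma deep_point_of_vanishing:
  assumes bc: "b > 0" "c > 0" and kl: "{k, l} = {1, 2}"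
    and p: "(p :: ratfun \<Rightarrow> 'k::field) \<in> cluster_points 2 f (bc_seed b c f e1 e2)"
    and v: "vanishing_values b c f e1 e2 k l p \<alpha> \<beta>"
    and cond: "bc_degree b c k > 1 \<or> CHAR('k) dvd bc_degree b c l"
  shows "p \<in> deep_points 2 f (bc_seed b c f e1 e2)"
proof -
  let ?s0 = "bc_seed b c f e1 e2"
  let ?A = "carrier (cluster_algebra 2 f ?s0)"
  have A: "hom_on_subring ?A p" using p by (simp add: cluster_points_iff)
  have cond': "bc_degree b c k > 1 \<or> of_nat (bc_degree b c l) = (0::'k)"
    using cond by (simp add: of_nat_eq_0_iff_char_dvd)
  have zero: "p (fst ?s0 l) = 0" "p (mutate_var (2 + f) l ?s0) = 0"
    using v by (simp_all add: vanishing_values_def bc_seed_simps)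
  have "l \<in> {1, 2}" using kl by auto
  then have l: "l \<in> {1..2 + f}" by auto
  have "p (fst s l) = 0" if "s \<in> reachable_seeds 2 f ?s0" for s
    using reachable_zeros[OF A bc_initial_mem(1) rank2_seed_bc bc_degree_pos[OF bc]
        bc_degree_pos[OF bc] bc_initial_mem(2) kl cond' zero that] by blast
  then have "\<exists>z\<in>C. p z = 0" if "C \<in> clusters 2 f ?s0" for C
    using that l unfolding clusters_def by blast
  then show ?thesis using p by (simp add: deep_points_def)
qed

text \<open>
  Since \<open>x\<^sub>k\<close> does not vanish, the initial cluster forces \<open>x\<^sub>l \<mapsto> 0\<close>, and the cluster obtained by exchanging \<open>x\<^sub>l\<close>
  forces \<open>x\<^sub>l' \<mapsto> 0\<close>. Now the exchange relation at \<open>l\<close> becomes the equation on \<open>\<alpha>\<close> and \<open>\<beta>\<close>, and the one at \<open>k\<close>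
  determines the value of \<open>x\<^sub>k'\<close>, which is nonzero. Hence the cluster reached by exchanging first \<open>x\<^sub>k\<close> and then \<open>x\<^sub>l\<close>
  forces the fourth variable to vanish, which is the condition on the exponents and the characteristic.
\<close>

lemma deep_point_classification:
  assumes bc: "b > 0" "c > 0" and kl: "{k, l} = {1, 2}"
    and p: "(p :: ratfun \<Rightarrow> 'k::field) \<in> deep_points 2 f (bc_seed b c f e1 e2)"
    and nz: "p (rvar k) \<noteq> 0"
  shows "bc_degree b c k > 1 \<or> CHAR('k) dvd bc_degree b c l"
    and "\<exists>\<alpha> \<beta>. deep_parameters (bc_degree b c l) f (bc_vec e1 e2 l) \<alpha> \<beta> \<and>
      vanishing_values b c f e1 e2 k l p \<alpha> \<beta>"
proof -
  let ?s0 = "bc_seed b c f e1 e2"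
  let ?A = "carrier (cluster_algebra 2 f ?s0)"
  let ?x' = "\<lambda>i. mutate_var (2 + f) i ?s0"
  have pV: "p \<in> cluster_points 2 f ?s0" using p by (simp add: deep_points_def)
  then have A: "hom_on_subring ?A p" by (simp add: cluster_points_iff)
  interpret hom_on_subring ?A p by (rule A)
  note s0 = rank2_seed_bc[of b c f e1 e2]
  note frozen = bc_initial_mem(1)[of _ f b c e1 e2] and mem = bc_initial_mem(2)[of _ b c f e1 e2]
  have kl': "k \<noteq> l" "k \<in> {1, 2}" "l \<in> {1, 2}" using kl by (auto simp: doubleton_eq_iff)
  have frozen_nz: "p (rvar i) \<noteq> 0" if "i \<in> {3..f+2}" for i
    using hom_inverse(1)[of "rvar i"] frozen[OF that] rvar_nonzero by blast
  have deep: "p (fst s k) = 0 \<or> p (fst s l) = 0" if s: "s \<in> reachable_seeds 2 f ?s0" for s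
  proof -
    have "fst s ` {1..2 + f} \<in> clusters 2 f ?s0" using s unfolding clusters_def by blast
    then obtain i where i: "i \<in> {1..2 + f}" "p (fst s i) = 0"
      using p unfolding deep_points_def by blast
    have "rank2_seed (bc_degree b c) f s"
      using reachable_seeds_mem[OF A frozen s0 bc_degree_pos[OF bc] bc_degree_pos[OF bc] mem s] by blast
    then have "i \<notin> {3..f+2}" using frozen_nz[of i] i by (auto simp: rank2_seed_def)
    then have "i \<in> {1, 2}" using i by auto
    then show ?thesis using i unfolding kl[symmetric] by auto
  qed
  note init = reachable_seeds.init[of ?s0 2 f]
  have step: "mutate (2 + f) i s \<in> reachable_seeds 2 f ?s0"
    if "s \<in> reachable_seeds 2 f ?s0" "i \<in> {1, 2}" for s i
    by (rule reachable_seeds.step) (use that in auto)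
  have xl: "p (rvar l) = 0" using deep[OF init] nz by (simp add: bc_seed_simps)
  have x'l: "p (?x' l) = 0"
    using deep[OF step[OF init kl'(3)]] nz kl' by (simp add: mutate_def bc_seed_simps)
  define \<alpha> where "\<alpha> = p (rvar k)"
  define \<beta> where "\<beta> = (\<lambda>j. p (bc_y j))"
  have \<beta>: "\<beta> j \<noteq> 0" if "j \<in> {1..f}" for j
    using cluster_point_values(1)[OF pV that] by (simp add: \<beta>_def)
  note exchange = cluster_point_values(2)[OF pV, folded \<beta>_def]
  have "vec_power f \<beta> (vec_pos (bc_vec e1 e2 l)) * \<alpha> ^ bc_degree b c l
      + vec_power f \<beta> (vec_neg (bc_vec e1 e2 l)) = 0"
    using exchange[of l k] kl xl by (simp add: insert_commute \<alpha>_def)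
  then have par: "deep_parameters (bc_degree b c l) f (bc_vec e1 e2 l) \<alpha> \<beta>"
    using deep_equation_iff[of f \<beta>] \<beta> nz unfolding deep_parameters_def \<alpha>_def by blast
  have "\<alpha> * p (?x' k) = vec_power f \<beta> (vec_neg (bc_vec e1 e2 k))"
    using exchange[OF kl] xl bc_degree_pos[OF bc, of k] by (simp add: \<alpha>_def power_0_left)
  then have x'k: "p (?x' k) = inverse \<alpha> * vec_power f \<beta> (vec_neg (bc_vec e1 e2 k))"
    using nz by (simp add: \<alpha>_def field_simps)
  show "\<exists>\<alpha> \<beta>. deep_parameters (bc_degree b c l) f (bc_vec e1 e2 l) \<alpha> \<beta> \<and>
      vanishing_values b c f e1 e2 k l p \<alpha> \<beta>"
    using par xl x'l x'k by (intro exI[of _ \<alpha>] exI[of _ \<beta>]) (simp add: vanishing_values_def \<alpha>_def \<beta>_def)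
  have "p (?x' k) \<noteq> 0"
    using x'k nz vec_power_nonzero[OF \<beta>] by (simp add: \<alpha>_def)
  then have "p (mutate_var (2 + f) l (mutate (2 + f) k ?s0)) = 0"
    using deep[OF step[OF step[OF init kl'(2)] kl'(3)]] kl'(1) by (simp add: mutate_def)
  then show "bc_degree b c k > 1 \<or> CHAR('k) dvd bc_degree b c l"
    using fourth_variable_at_zeros[OF A frozen s0 kl bc_degree_pos[OF bc] mem] xl x'l
    by (simp add: bc_seed_simps of_nat_eq_0_iff_char_dvd)
qed

text \<open>
  If both initial variables vanished, the exchange relation at \<open>x\<^sub>1\<close> would send its constant term, a monomial in
  the invertible frozen variables, to \<open>0\<close>.
\<close>

lemma cluster_point_initial_nonzero:
  fixes p :: "ratfun \<Rightarrow> 'k::field"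
  assumes "c > 0" and p: "p \<in> cluster_points 2 f (bc_seed b c f e1 e2)"
  shows "p (rvar 1) \<noteq> 0 \<or> p (rvar 2) \<noteq> 0"
proof -
  have "vec_power f (\<lambda>j. p (bc_y j)) (vec_neg (bc_vec e1 e2 1)) \<noteq> 0"
    by (rule vec_power_nonzero) (rule cluster_point_values(1)[OF p])
  then show ?thesis
    using cluster_point_values(2)[OF p, of 1 2] assms(1) by (auto simp: bc_degree_def zero_power)
qed

theorem theorem4p5:
  fixes b c f :: nat and e1 e2 :: "nat \<Rightarrow> int"
  assumes "b > 0" and "c > 0"
  shows
    "(c > 1 \<or> CHAR('k::field) dvd b \<longrightarrow>
       (\<forall>(\<alpha>::'k) \<beta>. deep_parameters b f e1 \<alpha> \<beta> \<longrightarrow>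
         (\<exists>p \<in> deep_points 2 f (bc_seed b c f e1 e2).
            has_values b c f e1 e2 p (0, \<alpha>, 0, inverse \<alpha> * vec_power f \<beta> (vec_neg e2)) \<beta> \<and>
            (\<forall>q \<in> cluster_points 2 f (bc_seed b c f e1 e2).
               has_values b c f e1 e2 q (0, \<alpha>, 0, inverse \<alpha> * vec_power f \<beta> (vec_neg e2)) \<beta>
                 \<longrightarrow> q = p))))
     \<and>
     (b > 1 \<or> CHAR('k) dvd c \<longrightarrow>
       (\<forall>(\<alpha>::'k) \<beta>. deep_parameters c f e2 \<alpha> \<beta> \<longrightarrow>
         (\<exists>p \<in> deep_points 2 f (bc_seed b c f e1 e2).
            has_values b c f e1 e2 p (inverse \<alpha> * vec_power f \<beta> (vec_neg e1), 0, \<alpha>, 0) \<beta> \<and>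
            (\<forall>q \<in> cluster_points 2 f (bc_seed b c f e1 e2).
               has_values b c f e1 e2 q (inverse \<alpha> * vec_power f \<beta> (vec_neg e1), 0, \<alpha>, 0) \<beta>
                 \<longrightarrow> q = p))))
     \<and>
     (\<forall>p \<in> (deep_points 2 f (bc_seed b c f e1 e2) :: (ratfun \<Rightarrow> 'k) set).
       ((c > 1 \<or> CHAR('k) dvd b) \<and> first_type b c f e1 e2 p \<or>
        (b > 1 \<or> CHAR('k) dvd c) \<and> second_type b c f e1 e2 p) \<and>
       \<not> (first_type b c f e1 e2 p \<and> second_type b c f e1 e2 p))"
proof -
  let ?D = "deep_points 2 f (bc_seed b c f e1 e2) :: (ratfun \<Rightarrow> 'k) set"
  let ?V = "cluster_points 2 f (bc_seed b c f e1 e2) :: (ratfun \<Rightarrow> 'k) set"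
  have exists: "\<exists>p\<in>?D. vanishing_values b c f e1 e2 k l p \<alpha> \<beta> \<and>
      (\<forall>q\<in>?V. vanishing_values b c f e1 e2 k l q \<alpha> \<beta> \<longrightarrow> q = p)"
    if kl: "{k, l} = {1, 2}" and cond: "bc_degree b c k > 1 \<or> CHAR('k) dvd bc_degree b c l"
      and par: "deep_parameters (bc_degree b c l) f (bc_vec e1 e2 l) \<alpha> \<beta>" for k l \<alpha> \<beta>
  proof -
    obtain p where p: "p \<in> ?V" "vanishing_values b c f e1 e2 k l p \<alpha> \<beta>"
      using cluster_point_exists[OF assms kl par] by blast
    moreover have "p \<in> ?D" by (rule deep_point_of_vanishing[OF assms kl p cond])
    ultimately show ?thesis using cluster_point_unique[OF assms kl p(1) _ p(2)] by blast
  qed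
  have simps: "bc_degree b c 1 = c" "bc_degree b c 2 = b" "bc_vec e1 e2 1 = e2" "bc_vec e1 e2 2 = e1"
    by (simp_all add: bc_degree_def bc_vec_def)
  have kl: "{1, 2} = {1, 2::nat}" "{2, 1} = {1, 2::nat}" by auto
  show ?thesis
  proof (intro conjI ballI impI allI)
    fix \<alpha> :: 'k and \<beta> assume "c > 1 \<or> CHAR('k) dvd b" "deep_parameters b f e1 \<alpha> \<beta>"
    then show "\<exists>p\<in>?D. has_values b c f e1 e2 p (0, \<alpha>, 0, inverse \<alpha> * vec_power f \<beta> (vec_neg e2)) \<beta> \<and>
        (\<forall>q\<in>?V. has_values b c f e1 e2 q (0, \<alpha>, 0, inverse \<alpha> * vec_power f \<beta> (vec_neg e2)) \<beta>
          \<longrightarrow> q = p)"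
      unfolding has_values_iff by (intro exists kl) (simp_all only: simps)
  next
    fix \<alpha> :: 'k and \<beta> assume "b > 1 \<or> CHAR('k) dvd c" "deep_parameters c f e2 \<alpha> \<beta>"
    then show "\<exists>p\<in>?D. has_values b c f e1 e2 p (inverse \<alpha> * vec_power f \<beta> (vec_neg e1), 0, \<alpha>, 0) \<beta> \<and>
        (\<forall>q\<in>?V. has_values b c f e1 e2 q (inverse \<alpha> * vec_power f \<beta> (vec_neg e1), 0, \<alpha>, 0) \<beta>
          \<longrightarrow> q = p)"
      unfolding has_values_iff by (intro exists kl) (simp_all only: simps)
  next
    fix p assume p: "p \<in> ?D"
    consider "p (rvar 1) \<noteq> 0" | "p (rvar 2) \<noteq> 0"
      using cluster_point_initial_nonzero[OF assms(2)] p unfolding deep_points_def by blast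
    then show "(c > 1 \<or> CHAR('k) dvd b) \<and> first_type b c f e1 e2 p \<or>
        (b > 1 \<or> CHAR('k) dvd c) \<and> second_type b c f e1 e2 p"
    proof cases
      case 1
      from deep_point_classification[OF assms kl(1) p 1] show ?thesis
        unfolding simps first_type_def has_values_iff by blast
    next
      case 2
      from deep_point_classification[OF assms kl(2) p 2] show ?thesis
        unfolding simps second_type_def has_values_iff by blast
    qed
    show "\<not> (first_type b c f e1 e2 p \<and> second_type b c f e1 e2 p)"
      by (auto simp: first_type_def second_type_def has_values_def deep_parameters_def)
  qed
qed

end
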